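(* A finite distributive lattice is a Shannon lattice if and only if its order dimension is at most $3$.
   Context: The order dimension of a finite distributive lattice $L$ is the maximal size of an antichain in the poset of join-irreducible elements of $L$ (equivalently, the maximal number of join-irreducible elements needed in an irredundant decomposition of an element as a join of join-irreducibles; equivalently, the least $n$ such that $L$ embeds as a sub-lattice into a product of $n$ chains). Lattices have order $\supseteq$, meet $\cap$, join $\uplus$. A polymatroid function on $L$ is $h:L\to\mathbb{R}$ that is non-negative, increasing ($x\supseteq y\Rightarrow h(x)\ge h(y)$) and submodular ($h(x)+h(y)\ge h(x\uplus y)+h(x\cap y)$). $h$ is entropic if there exist jointly distributed discrete random variables $(X_x)_{x\in L}$ such that for all $x,y$ the variable $X_{x\uplus y}$ and the pair $(X_x,X_y)$ are functions of each other, and $h(x)=H(X_x)$ (Shannon entropy). $L$ is a Shannon lattice if the set of polymatroid functions on $L$ equals the closure in $\mathbb{R}^L$ of the set of entropic functions on $L$. *)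

theory Defs
  imports "HOL-Analysis.Analysis" "HOL-Probability.Probability"
begin

text \<open>A finite distributive lattice is modelled as a type of class
  finite + distrib_lattice; the paper's order (reverse inclusion) is the
  class order, the paper's join is sup and its meet is inf.\<close>

definition join_irreducible :: "'a::distrib_lattice \<Rightarrow> bool" where
  "join_irreducible x \<longleftrightarrow>
     (\<exists>y. \<not> x \<le> y) \<and> (\<forall>y z. x = sup y z \<longrightarrow> x = y \<or> x = z)"

definition is_antichain :: "'a::order set \<Rightarrow> bool" where
  "is_antichain A \<longleftrightarrow> (\<forall>x\<in>A. \<forall>y\<in>A. x \<le> y \<longrightarrow> x = y)"

definition order_dimension :: "'a::{finite,distrib_lattice} itself \<Rightarrow> nat" where
  "order_dimension _ =
     Max {card A | A :: 'a set. A \<subseteq> {x. join_irreducible x} \<and> is_antichain A}"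

definition polymatroid :: "('a::distrib_lattice \<Rightarrow> real) \<Rightarrow> bool" where
  "polymatroid h \<longleftrightarrow>
     (\<forall>x. 0 \<le> h x) \<and> (\<forall>x y. y \<le> x \<longrightarrow> h y \<le> h x) \<and>
     (\<forall>x y. h (sup x y) + h (inf x y) \<le> h x + h y)"

definition entropy_pmf :: "nat pmf \<Rightarrow> real" where
  "entropy_pmf q = (\<Sum>\<^sub>\<infinity>v. - (pmf q v * log 2 (pmf q v)))"

definition finite_entropy_pmf :: "nat pmf \<Rightarrow> bool" where
  "finite_entropy_pmf q \<longleftrightarrow> (\<lambda>v. - (pmf q v * log 2 (pmf q v))) summable_on UNIV"

definition determines :: "'w pmf \<Rightarrow> ('w \<Rightarrow> 'b) \<Rightarrow> ('w \<Rightarrow> 'c) \<Rightarrow> bool" where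
  "determines \<mu> U V \<longleftrightarrow> (\<exists>g. \<forall>\<omega>\<in>set_pmf \<mu>. V \<omega> = g (U \<omega>))"

text \<open>Entropic functions: a joint distribution mu of discrete (nat-valued, which
  is no loss of generality) random variables (X_x)_x, with finite entropies.\<close>
definition entropic :: "('a::distrib_lattice \<Rightarrow> real) \<Rightarrow> bool" where
  "entropic h \<longleftrightarrow> (\<exists>\<mu> :: ('a \<Rightarrow> nat) pmf.
     (\<forall>x y. determines \<mu> (\<lambda>\<omega>. \<omega> (sup x y)) (\<lambda>\<omega>. (\<omega> x, \<omega> y)) \<and>
            determines \<mu> (\<lambda>\<omega>. (\<omega> x, \<omega> y)) (\<lambda>\<omega>. \<omega> (sup x y))) \<and>
     (\<forall>x. finite_entropy_pmf (map_pmf (\<lambda>\<omega>. \<omega> x) \<mu>) \<and>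
          h x = entropy_pmf (map_pmf (\<lambda>\<omega>. \<omega> x) \<mu>)))"

definition shannon_lattice :: "'a::{finite,distrib_lattice} itself \<Rightarrow> bool" where
  "shannon_lattice _ \<longleftrightarrow>
     {h :: 'a \<Rightarrow> real. polymatroid h} = closure {h. entropic h}"

end

theory Submission
  imports Defs "HOL-Library.Function_Algebras" "HOL-Real_Asymp.Real_Asymp"
begin

text \<open>
  Entropic functions satisfy the Shannon inequalities and the Zhang-Yeung inequality, and so do their
  limits. Four pairwise incomparable join-irreducibles map the lattice onto the Boolean lattice with
  four atoms, since join-irreducibles are prime; a polymatroid on the latter that violates the
  Zhang-Yeung inequality pulls back to a polymatroid that is not a limit of entropic functions.

  Conversely, if no four join-irreducibles are incomparable, Dilworth's theorem covers them by three
  chains, and every element is \<open>A i \<squnion> B j \<squnion> C k\<close> with members of the three chains. After scaling and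
  rounding, the polymatroid \<open>g\<close> is integral, and it is realised by three descending flags of
  subgroups of \<open>\<bbbZ>\<^sub>2\<^sup>n\<close> whose intersections have order \<open>2 ^ (g top - g (A i \<squnion> B j \<squnion> C k))\<close>. Two flags
  always have common coordinates, each described by the level at which either flag kills it; their
  joint position is the number \<open>R i j\<close> of coordinates surviving both levels \<open>i\<close> and \<open>j\<close>. Passing from
  \<open>C k\<close> to \<open>C (k + 1)\<close> has to lower \<open>R\<close> by a function \<open>\<delta>\<close> which is decreasing in \<open>i\<close> and \<open>j\<close>.
  Imposing the vanishing of the sum of one coordinate for each outer corner of the down-set
  \<open>{\<delta> \<ge> 1}\<close> lowers \<open>R\<close> by one exactly on that set, because the partial sums along this staircase are
  new common coordinates; iterating exhausts \<open>\<delta>\<close>. Finally, using the resulting variables only with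
  probability \<open>1 / N\<close> scales the entropies back at the cost of a vanishing error.
\<close>

section \<open>Entropy of discrete random variables\<close>

text \<open>Entropy is taken as an expectation over the sample space rather than a sum over values,
  so variables with different value types can be compared pointwise.\<close>

definition atom_prob :: "'w pmf \<Rightarrow> ('w \<Rightarrow> 'b) \<Rightarrow> 'w \<Rightarrow> real" where
  "atom_prob \<mu> X \<omega> = measure_pmf.prob \<mu> {\<omega>'. X \<omega>' = X \<omega>}"

definition finite_ent :: "'w pmf \<Rightarrow> ('w \<Rightarrow> 'b) \<Rightarrow> bool" where
  "finite_ent \<mu> X \<longleftrightarrow> integrable (measure_pmf \<mu>) (\<lambda>\<omega>. - log 2 (atom_prob \<mu> X \<omega>))"

definition ent :: "'w pmf \<Rightarrow> ('w \<Rightarrow> 'b) \<Rightarrow> real" where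
  "ent \<mu> X = measure_pmf.expectation \<mu> (\<lambda>\<omega>. - log 2 (atom_prob \<mu> X \<omega>))"

lemma pmf_map_eq_atom_prob: "pmf (map_pmf X \<mu>) (X \<omega>) = atom_prob \<mu> X \<omega>"
  by (simp add: atom_prob_def pmf_map vimage_def)

lemma atom_prob_le_1: "atom_prob \<mu> X \<omega> \<le> 1"
  by (simp add: atom_prob_def)

lemma atom_prob_pos: "\<omega> \<in> set_pmf \<mu> \<Longrightarrow> 0 < atom_prob \<mu> X \<omega>"
  unfolding pmf_map_eq_atom_prob[symmetric] by (simp add: pmf_positive_iff)

lemma neg_log_atom_prob_nonneg: "0 \<le> - log 2 (atom_prob \<mu> X \<omega>)"
proof (cases "atom_prob \<mu> X \<omega> = 0")
  case False
  then have "0 < atom_prob \<mu> X \<omega>"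
    by (simp add: atom_prob_def zero_less_measure_iff)
  then show ?thesis using atom_prob_le_1[of \<mu> X \<omega>] by simp
qed (simp add: log_def)

text \<open>Bridge to the infinite sum in \<open>entropy_pmf\<close>: for real functions,
  unconditional summability is absolute summability, that is, integrability for the counting
  measure.\<close>

lemma integrable_measure_pmf_iff_summable:
  fixes f :: "'v \<Rightarrow> real"
  shows "integrable (measure_pmf p) f \<longleftrightarrow> (\<lambda>v. pmf p v * f v) summable_on UNIV"
proof -
  have "integrable (measure_pmf p) f \<longleftrightarrow> integrable (count_space UNIV) (\<lambda>v. pmf p v *\<^sub>R f v)"
    by (subst measure_pmf_eq_density, rule integrable_density) auto
  also have "\<dots> \<longleftrightarrow> (\<lambda>v. pmf p v * f v) summable_on UNIV"
    by (subst summable_on_iff_abs_summable_on_real, subst abs_summable_equivalent)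
      (simp add: Infinite_Set_Sum.abs_summable_on_def)
  finally show ?thesis .
qed

lemma expectation_eq_infsum:
  fixes f :: "'v \<Rightarrow> real"
  assumes "integrable (measure_pmf p) f"
  shows "measure_pmf.expectation p f = (\<Sum>\<^sub>\<infinity>v. pmf p v * f v)"
proof -
  have *: "Infinite_Set_Sum.abs_summable_on (\<lambda>v. pmf p v * f v) UNIV"
    using assms unfolding integrable_measure_pmf_iff_summable abs_summable_equivalent[symmetric]
    by (rule summable_on_iff_abs_summable_on_real[THEN iffD1])
  have "measure_pmf.expectation p f = integral\<^sup>L (count_space UNIV) (\<lambda>v. pmf p v *\<^sub>R f v)"
    by (subst measure_pmf_eq_density, rule integral_density) auto
  also have "\<dots> = (\<Sum>\<^sub>\<infinity>v. pmf p v * f v)"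
    unfolding infsetsum_infsum[OF *, symmetric] by (simp add: infsetsum_def)
  finally show ?thesis .
qed

lemma finite_entropy_pmf_map: "finite_entropy_pmf (map_pmf X \<mu>) \<longleftrightarrow> finite_ent \<mu> X"
  using integrable_measure_pmf_iff_summable[of "map_pmf X \<mu>" "\<lambda>v. - log 2 (pmf (map_pmf X \<mu>) v)"]
  unfolding integrable_map_pmf_eq pmf_map_eq_atom_prob
  by (simp add: finite_entropy_pmf_def finite_ent_def)

lemma entropy_pmf_map: "finite_ent \<mu> X \<Longrightarrow> entropy_pmf (map_pmf X \<mu>) = ent \<mu> X"
  using expectation_eq_infsum[of "map_pmf X \<mu>" "\<lambda>v. - log 2 (pmf (map_pmf X \<mu>) v)"]
  unfolding integrable_map_pmf_eq integral_map_pmf pmf_map_eq_atom_prob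
  by (simp add: entropy_pmf_def finite_ent_def ent_def)

section \<open>Functional dependence and monotonicity of entropy\<close>

lemma determinesD:
  "determines \<mu> U V \<Longrightarrow> \<omega> \<in> set_pmf \<mu> \<Longrightarrow> \<omega>' \<in> set_pmf \<mu> \<Longrightarrow> U \<omega> = U \<omega>' \<Longrightarrow> V \<omega> = V \<omega>'"
  unfolding determines_def by fastforce

lemma determinesI:
  assumes "\<And>\<omega> \<omega>'. \<omega> \<in> set_pmf \<mu> \<Longrightarrow> \<omega>' \<in> set_pmf \<mu> \<Longrightarrow> U \<omega> = U \<omega>' \<Longrightarrow> V \<omega> = V \<omega>'"
  shows "determines \<mu> U V"
  unfolding determines_def
proof (intro exI ballI)
  fix \<omega> assume \<omega>: "\<omega> \<in> set_pmf \<mu>"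
  \<comment> \<open>The factor map sends a value of \<open>U\<close> to the value of
    \<open>V\<close> at some support point where \<open>U\<close> takes it.\<close>
  show "V \<omega> = V (SOME \<omega>'. \<omega>' \<in> set_pmf \<mu> \<and> U \<omega>' = U \<omega>)"
    using someI[of "\<lambda>\<omega>'. \<omega>' \<in> set_pmf \<mu> \<and> U \<omega>' = U \<omega>" \<omega>] \<omega> assms by metis
qed

lemma prob_mono_support:
  assumes "\<And>\<omega>. \<omega> \<in> set_pmf \<mu> \<Longrightarrow> \<omega> \<in> S \<Longrightarrow> \<omega> \<in> T"
  shows "measure_pmf.prob \<mu> S \<le> measure_pmf.prob \<mu> T"
proof -
  have "measure_pmf.prob \<mu> S = measure_pmf.prob \<mu> (S \<inter> set_pmf \<mu>)"
    by (simp add: measure_Int_set_pmf)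
  also have "\<dots> \<le> measure_pmf.prob \<mu> T"
    using assms by (intro measure_pmf.finite_measure_mono) auto
  finally show ?thesis .
qed

lemma prob_cong_support:
  assumes "\<And>\<omega>. \<omega> \<in> set_pmf \<mu> \<Longrightarrow> \<omega> \<in> S \<longleftrightarrow> \<omega> \<in> T"
  shows "measure_pmf.prob \<mu> S = measure_pmf.prob \<mu> T"
  by (intro antisym prob_mono_support) (use assms in auto)

text \<open>On the support each fibre of \<open>U\<close> lies inside a fibre of \<open>V\<close>.
  Finiteness and monotonicity of entropy both follow from this pointwise comparison.\<close>

lemma atom_prob_determines_le:
  assumes "determines \<mu> U V" "\<omega> \<in> set_pmf \<mu>"
  shows "atom_prob \<mu> U \<omega> \<le> atom_prob \<mu> V \<omega>"
  unfolding atom_prob_def using determinesD[OF assms(1) _ assms(2)]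
  by (intro prob_mono_support) auto

lemma neg_log_atom_prob_determines:
  assumes "determines \<mu> U V" "\<omega> \<in> set_pmf \<mu>"
  shows "- log 2 (atom_prob \<mu> V \<omega>) \<le> - log 2 (atom_prob \<mu> U \<omega>)"
  using atom_prob_determines_le[OF assms] atom_prob_pos[OF assms(2), of U] by simp

lemma finite_ent_determines:
  assumes "determines \<mu> U V" "finite_ent \<mu> U"
  shows "finite_ent \<mu> V"
  unfolding finite_ent_def
proof (rule Bochner_Integration.integrable_bound)
  show "integrable (measure_pmf \<mu>) (\<lambda>\<omega>. - log 2 (atom_prob \<mu> U \<omega>))"
    using assms(2) by (simp add: finite_ent_def)
  show "AE \<omega> in measure_pmf \<mu>. norm (- log 2 (atom_prob \<mu> V \<omega>)) \<le> norm (- log 2 (atom_prob \<mu> U \<omega>))"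
    unfolding AE_measure_pmf_iff real_norm_def
    using neg_log_atom_prob_determines[OF assms(1)] neg_log_atom_prob_nonneg
    by (metis abs_of_nonneg)
qed simp

lemma ent_determines_le:
  assumes "determines \<mu> U V" "finite_ent \<mu> U"
  shows "ent \<mu> V \<le> ent \<mu> U"
  unfolding ent_def
  using assms(2) finite_ent_determines[OF assms] neg_log_atom_prob_determines[OF assms(1)]
  by (intro integral_mono_AE) (auto simp: finite_ent_def AE_measure_pmf_iff)

lemma ent_determines_eq:
  assumes "determines \<mu> U V" "determines \<mu> V U" "finite_ent \<mu> U"
  shows "ent \<mu> V = ent \<mu> U"
  using assms finite_ent_determines by (intro antisym ent_determines_le) auto

lemma ent_nonneg: "0 \<le> ent \<mu> X"
  unfolding ent_def by (intro integral_nonneg_AE AE_I2 neg_log_atom_prob_nonneg)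

section \<open>Push-forwards and conditionally independent copies\<close>

lemma atom_prob_map_pmf: "atom_prob (map_pmf f \<mu>) X (f \<omega>) = atom_prob \<mu> (\<lambda>\<omega>. X (f \<omega>)) \<omega>"
  by (simp add: atom_prob_def measure_map_pmf vimage_def)

lemma finite_ent_map_pmf: "finite_ent (map_pmf f \<mu>) X \<longleftrightarrow> finite_ent \<mu> (\<lambda>\<omega>. X (f \<omega>))"
  by (simp add: finite_ent_def integrable_map_pmf_eq atom_prob_map_pmf)

lemma ent_map_pmf: "ent (map_pmf f \<mu>) X = ent \<mu> (\<lambda>\<omega>. X (f \<omega>))"
  by (simp add: ent_def atom_prob_map_pmf)

text \<open>Two samples of \<open>\<mu>\<close> that agree on \<open>Z\<close> and are conditionally independent given \<open>Z\<close>.\<close>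
definition copy_pmf :: "'w pmf \<Rightarrow> ('w \<Rightarrow> 'c) \<Rightarrow> ('w \<times> 'w) pmf" where
  "copy_pmf \<mu> Z = bind_pmf \<mu> (\<lambda>\<omega>. map_pmf (Pair \<omega>) (cond_pmf \<mu> {\<omega>'. Z \<omega>' = Z \<omega>}))"

lemma map_fst_copy_pmf: "map_pmf fst (copy_pmf \<mu> Z) = \<mu>"
  by (simp add: copy_pmf_def map_bind_pmf map_pmf_comp bind_return_pmf')

text \<open>Resampling within the fibre of \<open>Z\<close> that was hit does not change the
  law.\<close>

lemma map_snd_copy_pmf: "map_pmf snd (copy_pmf \<mu> Z) = \<mu>"
proof -
  have "bind_pmf \<mu> (\<lambda>x. cond_pmf \<mu> {y. Z y = Z x}) = \<mu>"
    by (rule bind_cond_pmf_cancel) (auto intro!: arg_cong[where f = "measure_pmf.prob \<mu>"])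
  then show ?thesis by (simp add: copy_pmf_def map_bind_pmf map_pmf_comp)
qed

lemma set_copy_pmf:
  "set_pmf (copy_pmf \<mu> Z) = {(\<omega>, \<omega>'). \<omega> \<in> set_pmf \<mu> \<and> \<omega>' \<in> set_pmf \<mu> \<and> Z \<omega> = Z \<omega>'}"
proof -
  have "set_pmf (cond_pmf \<mu> {\<omega>'. Z \<omega>' = Z \<omega>}) = set_pmf \<mu> \<inter> {\<omega>'. Z \<omega>' = Z \<omega>}"
    if "\<omega> \<in> set_pmf \<mu>" for \<omega>
    using that by (intro set_cond_pmf) auto
  then show ?thesis by (auto simp: copy_pmf_def)
qed

text \<open>Every first sample satisfying \<open>P\<close> has \<open>Z = z\<close>, so the second
  one always comes from the same conditional law; hence the product form.\<close>

lemma prob_copy_pmf: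
  assumes z: "\<And>\<omega>. \<omega> \<in> set_pmf \<mu> \<Longrightarrow> P \<omega> \<Longrightarrow> Z \<omega> = z"
  shows "measure_pmf.prob (copy_pmf \<mu> Z) {(\<omega>, \<omega>'). P \<omega> \<and> Q \<omega>'} =
    measure_pmf.prob \<mu> {\<omega>. P \<omega>} * (measure_pmf.prob \<mu> {\<omega>. Q \<omega> \<and> Z \<omega> = z} / measure_pmf.prob \<mu> {\<omega>. Z \<omega> = z})"
proof -
  let ?q = "measure_pmf.prob \<mu> {\<omega>. Q \<omega> \<and> Z \<omega> = z} / measure_pmf.prob \<mu> {\<omega>. Z \<omega> = z}"
  have inner: "emeasure (measure_pmf (map_pmf (Pair \<omega>) (cond_pmf \<mu> {\<omega>'. Z \<omega>' = Z \<omega>}))) {(\<omega>, \<omega>'). P \<omega> \<and> Q \<omega>'}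
      = ennreal ?q * indicator {\<omega>. P \<omega>} \<omega>" if \<omega>: "\<omega> \<in> set_pmf \<mu>" for \<omega>
  proof (cases "P \<omega>")
    case True
    then have Z: "Z \<omega> = z" using z \<omega> by auto
    have ne: "set_pmf \<mu> \<inter> {\<omega>'. Z \<omega>' = z} \<noteq> {}" using \<omega> Z by auto
    have "measure_pmf.prob \<mu> {\<omega>'. Z \<omega>' = z} \<noteq> 0"
      using atom_prob_pos[OF \<omega>, of Z] Z by (simp add: atom_prob_def)
    then have ne0: "emeasure (measure_pmf \<mu>) {\<omega>'. Z \<omega>' = z} \<noteq> 0"
      by (simp add: measure_pmf.emeasure_eq_measure)
    have "measure_pmf.prob (cond_pmf \<mu> {\<omega>'. Z \<omega>' = z}) {\<omega>'. Q \<omega>'} = ?q"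
      unfolding cond_pmf.rep_eq[OF ne]
      using ne0 by (subst measure_uniform_measure) (auto simp: Int_def conj_commute)
    then show ?thesis using True Z
      by (simp add: vimage_def measure_pmf.emeasure_eq_measure)
  qed (simp add: vimage_def)
  have "emeasure (measure_pmf (copy_pmf \<mu> Z)) {(\<omega>, \<omega>'). P \<omega> \<and> Q \<omega>'}
      = (\<integral>\<^sup>+\<omega>. ennreal ?q * indicator {\<omega>. P \<omega>} \<omega> \<partial>measure_pmf \<mu>)"
    unfolding copy_pmf_def emeasure_bind_pmf
    by (intro nn_integral_cong_AE) (use inner in \<open>unfold AE_measure_pmf_iff, blast\<close>)
  also have "\<dots> = ennreal ?q * emeasure (measure_pmf \<mu>) {\<omega>. P \<omega>}"
    by (subst nn_integral_cmult_indicator) auto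
  also have "\<dots> = ennreal (measure_pmf.prob \<mu> {\<omega>. P \<omega>} * ?q)"
    unfolding measure_pmf.emeasure_eq_measure
    by (subst ennreal_mult''[symmetric]) (auto simp: mult.commute)
  finally show ?thesis
    by (simp add: measure_pmf.emeasure_eq_measure)
qed

text \<open>Nonnegativity of relative entropy: \<open>ln r \<le> r - 1\<close> for the likelihood
  ratio \<open>r\<close>, whose expectation is at most 1. It can be smaller because \<open>Q\<close>
  may charge values that \<open>W\<close> does not take.\<close>

lemma gibbs_inequality:
  fixes Q :: "'b pmf"
  assumes fin: "finite_ent \<mu> W"
    and int: "integrable (measure_pmf \<mu>) (\<lambda>\<omega>. log 2 (pmf Q (W \<omega>)))"
    and pos: "\<And>\<omega>. \<omega> \<in> set_pmf \<mu> \<Longrightarrow> 0 < pmf Q (W \<omega>)"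
  shows "ent \<mu> W \<le> - measure_pmf.expectation \<mu> (\<lambda>\<omega>. log 2 (pmf Q (W \<omega>)))"
proof -
  let ?r = "\<lambda>\<omega>. pmf Q (W \<omega>) / atom_prob \<mu> W \<omega>"
  have nonneg: "0 \<le> ?r \<omega>" for \<omega> by (simp add: atom_prob_def)
  have "(\<integral>\<^sup>+\<omega>. ennreal (?r \<omega>) \<partial>measure_pmf \<mu>)
      = (\<integral>\<^sup>+v. ennreal (pmf Q v / pmf (map_pmf W \<mu>) v) \<partial>measure_pmf (map_pmf W \<mu>))"
    by (simp add: pmf_map_eq_atom_prob)
  also have "\<dots> = (\<integral>\<^sup>+v. ennreal (pmf (map_pmf W \<mu>) v) * ennreal (pmf Q v / pmf (map_pmf W \<mu>) v) \<partial>count_space UNIV)"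
    by (rule nn_integral_measure_pmf)
  also have "\<dots> \<le> (\<integral>\<^sup>+v. ennreal (pmf Q v) \<partial>count_space UNIV)"
    by (intro nn_integral_mono) (auto simp: ennreal_mult'[symmetric])
  also have "\<dots> = 1" by (rule nn_integral_pmf_eq_1)
  finally have le1: "(\<integral>\<^sup>+\<omega>. ennreal (?r \<omega>) \<partial>measure_pmf \<mu>) \<le> 1" .
  have intr: "integrable (measure_pmf \<mu>) ?r"
    using le1 nonneg by (intro integrableI_nonneg) (auto intro: le_less_trans)
  have "ennreal (measure_pmf.expectation \<mu> ?r) \<le> 1"
    using le1 nn_integral_eq_integral[OF intr] nonneg by simp
  then have exp1: "measure_pmf.expectation \<mu> ?r \<le> 1" by simp
  have "0 \<le> measure_pmf.expectation \<mu> (\<lambda>\<omega>. (1 - ?r \<omega>) / ln 2)"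
    using exp1 intr by (simp add: measure_pmf.prob_space)
  also have "\<dots> \<le> measure_pmf.expectation \<mu> (\<lambda>\<omega>. log 2 (atom_prob \<mu> W \<omega>) - log 2 (pmf Q (W \<omega>)))"
  proof (intro integral_mono_AE)
    show "AE \<omega> in measure_pmf \<mu>. (1 - ?r \<omega>) / ln 2 \<le> log 2 (atom_prob \<mu> W \<omega>) - log 2 (pmf Q (W \<omega>))"
      unfolding AE_measure_pmf_iff
    proof
      fix \<omega> assume \<omega>: "\<omega> \<in> set_pmf \<mu>"
      have "ln (?r \<omega>) \<le> ?r \<omega> - 1"
        using pos[OF \<omega>] atom_prob_pos[OF \<omega>, of W] by (intro ln_le_minus_one) simp
      moreover have "ln (?r \<omega>) = ln (pmf Q (W \<omega>)) - ln (atom_prob \<mu> W \<omega>)"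
        using pos[OF \<omega>] atom_prob_pos[OF \<omega>, of W] by (simp add: ln_div)
      ultimately show "(1 - ?r \<omega>) / ln 2 \<le> log 2 (atom_prob \<mu> W \<omega>) - log 2 (pmf Q (W \<omega>))"
        by (simp add: log_def diff_divide_distrib[symmetric] divide_right_mono)
    qed
  qed (use intr fin int in \<open>auto simp: finite_ent_def\<close>)
  also have "\<dots> = - ent \<mu> W - measure_pmf.expectation \<mu> (\<lambda>\<omega>. log 2 (pmf Q (W \<omega>)))"
    using fin int by (simp add: finite_ent_def ent_def)
  finally show ?thesis by simp
qed

text \<open>Gibbs' inequality with \<open>Q\<close> the law that makes \<open>X\<close> and
  \<open>Y\<close> conditionally independent given their common part \<open>Z\<close>; the logarithm
  of \<open>Q\<close> then splits into three entropy terms.\<close>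

lemma ent_submodular:
  assumes X: "determines \<mu> X Z" and Y: "determines \<mu> Y Z"
    and fin: "finite_ent \<mu> X" "finite_ent \<mu> Y" "finite_ent \<mu> (\<lambda>\<omega>. (X \<omega>, Y \<omega>))"
  shows "ent \<mu> (\<lambda>\<omega>. (X \<omega>, Y \<omega>)) + ent \<mu> Z \<le> ent \<mu> X + ent \<mu> Y"
proof -
  let ?Q = "map_pmf (\<lambda>(\<omega>, \<omega>'). (X \<omega>, Y \<omega>')) (copy_pmf \<mu> Z)"
  have finZ: "finite_ent \<mu> Z" using finite_ent_determines X fin(1) by blast
  have q: "pmf ?Q (X \<omega>, Y \<omega>) = atom_prob \<mu> X \<omega> * (atom_prob \<mu> Y \<omega> / atom_prob \<mu> Z \<omega>)"
    if \<omega>: "\<omega> \<in> set_pmf \<mu>" for \<omega>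
  proof -
    have "pmf ?Q (X \<omega>, Y \<omega>) = measure_pmf.prob (copy_pmf \<mu> Z) {(\<omega>1, \<omega>2). X \<omega>1 = X \<omega> \<and> Y \<omega>2 = Y \<omega>}"
      by (auto simp: pmf_map intro!: arg_cong[where f = "measure_pmf.prob _"])
    also have "\<dots> = measure_pmf.prob \<mu> {\<omega>1. X \<omega>1 = X \<omega>} *
      (measure_pmf.prob \<mu> {\<omega>2. Y \<omega>2 = Y \<omega> \<and> Z \<omega>2 = Z \<omega>} / measure_pmf.prob \<mu> {\<omega>2. Z \<omega>2 = Z \<omega>})"
      using determinesD[OF X _ \<omega>] by (intro prob_copy_pmf) auto
    also have "measure_pmf.prob \<mu> {\<omega>2. Y \<omega>2 = Y \<omega> \<and> Z \<omega>2 = Z \<omega>} = measure_pmf.prob \<mu> {\<omega>2. Y \<omega>2 = Y \<omega>}"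
      using determinesD[OF Y _ \<omega>] by (intro prob_cong_support) auto
    finally show ?thesis by (simp add: atom_prob_def)
  qed
  have logq: "log 2 (pmf ?Q (X \<omega>, Y \<omega>)) =
      log 2 (atom_prob \<mu> X \<omega>) + log 2 (atom_prob \<mu> Y \<omega>) - log 2 (atom_prob \<mu> Z \<omega>)"
    if \<omega>: "\<omega> \<in> set_pmf \<mu>" for \<omega>
    using atom_prob_pos[OF \<omega>, of X] atom_prob_pos[OF \<omega>, of Y] atom_prob_pos[OF \<omega>, of Z]
    by (simp add: q[OF \<omega>] log_mult log_divide)
  have int: "integrable (measure_pmf \<mu>) (\<lambda>\<omega>. log 2 (atom_prob \<mu> X \<omega>) + log 2 (atom_prob \<mu> Y \<omega>) - log 2 (atom_prob \<mu> Z \<omega>))"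
    using fin finZ by (auto simp: finite_ent_def)
  have "ent \<mu> (\<lambda>\<omega>. (X \<omega>, Y \<omega>)) \<le> - measure_pmf.expectation \<mu> (\<lambda>\<omega>. log 2 (pmf ?Q (X \<omega>, Y \<omega>)))"
  proof (rule gibbs_inequality)
    show "integrable (measure_pmf \<mu>) (\<lambda>\<omega>. log 2 (pmf ?Q (X \<omega>, Y \<omega>)))"
      using int by (rule integrable_cong_AE_imp) (auto simp: AE_measure_pmf_iff logq)
    show "0 < pmf ?Q (X \<omega>, Y \<omega>)" if "\<omega> \<in> set_pmf \<mu>" for \<omega>
      using that by (simp add: q atom_prob_pos)
  qed (rule fin)
  also have "measure_pmf.expectation \<mu> (\<lambda>\<omega>. log 2 (pmf ?Q (X \<omega>, Y \<omega>))) =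
      measure_pmf.expectation \<mu> (\<lambda>\<omega>. log 2 (atom_prob \<mu> X \<omega>) + log 2 (atom_prob \<mu> Y \<omega>) - log 2 (atom_prob \<mu> Z \<omega>))"
    by (intro integral_cong_AE) (auto simp: AE_measure_pmf_iff logq)
  finally show ?thesis
    using fin finZ by (simp add: finite_ent_def ent_def)
qed

section \<open>The Zhang-Yeung inequality\<close>

text \<open>Comparing values directly, instead of asking for two factor maps, makes such claims
  about tuples and joint variables accessible to simplification.\<close>

definition same_info :: "'w pmf \<Rightarrow> ('w \<Rightarrow> 'b) \<Rightarrow> ('w \<Rightarrow> 'c) \<Rightarrow> bool" where
  "same_info \<mu> U V \<longleftrightarrow> (\<forall>\<omega>\<in>set_pmf \<mu>. \<forall>\<omega>'\<in>set_pmf \<mu>. U \<omega> = U \<omega>' \<longleftrightarrow> V \<omega> = V \<omega>')"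

lemma same_info_iff_determines:
  "same_info \<mu> U V \<longleftrightarrow> determines \<mu> U V \<and> determines \<mu> V U"
proof
  assume *: "same_info \<mu> U V"
  show "determines \<mu> U V \<and> determines \<mu> V U"
    using * unfolding same_info_def by (intro conjI determinesI) blast+
next
  assume *: "determines \<mu> U V \<and> determines \<mu> V U"
  show "same_info \<mu> U V"
    unfolding same_info_def
    using determinesD[OF conjunct1[OF *]] determinesD[OF conjunct2[OF *]] by blast
qed

lemma finite_ent_same_info: "same_info \<mu> U V \<Longrightarrow> finite_ent \<mu> U \<longleftrightarrow> finite_ent \<mu> V"
  unfolding same_info_iff_determines
  using finite_ent_determines[of \<mu> U V] finite_ent_determines[of \<mu> V U] by blast

lemma ent_same_info: "same_info \<mu> U V \<Longrightarrow> finite_ent \<mu> U \<Longrightarrow> ent \<mu> U = ent \<mu> V"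
  unfolding same_info_iff_determines using ent_determines_eq[of \<mu> U V] by simp

text \<open>\<open>restrict\<close> gives all subfamilies one common type, so that entropy becomes a
  function of the index set.\<close>

definition joint :: "('i \<Rightarrow> 'w \<Rightarrow> 'b) \<Rightarrow> 'i set \<Rightarrow> 'w \<Rightarrow> 'i \<Rightarrow> 'b" where
  "joint X S \<omega> = restrict (\<lambda>i. X i \<omega>) S"

lemma joint_eq_iff: "joint X S \<omega> = joint Y S \<omega>' \<longleftrightarrow> (\<forall>i\<in>S. X i \<omega> = Y i \<omega>')"
  by (auto simp: joint_def restrict_def fun_eq_iff)

lemma determines_joint: "S \<subseteq> T \<Longrightarrow> determines \<mu> (joint X T) (joint X S)"
  by (rule determinesI) (auto simp: joint_eq_iff)

lemma joint_submodular:
  assumes fin: "finite_ent \<mu> (joint X U)" and ST: "S \<subseteq> U" "T \<subseteq> U"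
  shows "ent \<mu> (joint X (S \<union> T)) + ent \<mu> (joint X (S \<inter> T)) \<le> ent \<mu> (joint X S) + ent \<mu> (joint X T)"
proof -
  have fin': "finite_ent \<mu> (joint X V)" if "V \<subseteq> U" for V
    using finite_ent_determines[OF determines_joint[OF that] fin] .
  have si: "same_info \<mu> (joint X (S \<union> T)) (\<lambda>\<omega>. (joint X S \<omega>, joint X T \<omega>))"
    by (auto simp: same_info_def joint_eq_iff)
  have "finite_ent \<mu> (\<lambda>\<omega>. (joint X S \<omega>, joint X T \<omega>))"
    using finite_ent_same_info[OF si] fin' ST by simp
  then have "ent \<mu> (\<lambda>\<omega>. (joint X S \<omega>, joint X T \<omega>)) + ent \<mu> (joint X (S \<inter> T)) \<le> ent \<mu> (joint X S) + ent \<mu> (joint X T)"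
    using fin' ST by (intro ent_submodular determines_joint) auto
  then show ?thesis using ent_same_info[OF si] fin' ST by simp
qed

text \<open>\<open>U\<close> of the first sample and \<open>V\<close> of the second are independent
  given \<open>Z\<close>, so atom probabilities factor and submodularity becomes an
  equality.\<close>

lemma copy_pmf_joint_entropy:
  assumes U: "determines \<mu> U Z" and fin: "finite_ent \<mu> U" "finite_ent \<mu> (\<lambda>\<omega>. (V \<omega>, Z \<omega>))"
  shows "finite_ent (copy_pmf \<mu> Z) (\<lambda>(\<omega>, \<omega>'). (U \<omega>, V \<omega>'))" (is ?fin)
    and "ent (copy_pmf \<mu> Z) (\<lambda>(\<omega>, \<omega>'). (U \<omega>, V \<omega>')) = ent \<mu> U + ent \<mu> (\<lambda>\<omega>. (V \<omega>, Z \<omega>)) - ent \<mu> Z" (is ?eq)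
proof -
  let ?\<nu> = "copy_pmf \<mu> Z" and ?T = "\<lambda>(\<omega>, \<omega>'). (U \<omega>, V \<omega>')" and ?VZ = "\<lambda>\<omega>. (V \<omega>, Z \<omega>)"
  have finZ: "finite_ent \<mu> Z" using finite_ent_determines[OF U] fin by blast
  have p: "atom_prob ?\<nu> ?T p = atom_prob \<mu> U (fst p) * (atom_prob \<mu> ?VZ (snd p) / atom_prob \<mu> Z (snd p))"
    if pin: "p \<in> set_pmf ?\<nu>" for p
  proof -
    obtain \<omega> \<omega>' where p: "p = (\<omega>, \<omega>')" and \<omega>: "\<omega> \<in> set_pmf \<mu>" "\<omega>' \<in> set_pmf \<mu>" "Z \<omega> = Z \<omega>'"
      using pin by (auto simp: set_copy_pmf)
    have "atom_prob ?\<nu> ?T p = measure_pmf.prob ?\<nu> {(\<omega>1, \<omega>2). U \<omega>1 = U \<omega> \<and> V \<omega>2 = V \<omega>'}"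
      unfolding atom_prob_def p by (auto intro!: arg_cong[where f = "measure_pmf.prob _"])
    also have "\<dots> = measure_pmf.prob \<mu> {\<omega>1. U \<omega>1 = U \<omega>} *
        (measure_pmf.prob \<mu> {\<omega>2. V \<omega>2 = V \<omega>' \<and> Z \<omega>2 = Z \<omega>'} / measure_pmf.prob \<mu> {\<omega>2. Z \<omega>2 = Z \<omega>'})"
      using determinesD[OF U _ \<omega>(1)] \<omega>(3) by (intro prob_copy_pmf) auto
    finally show ?thesis by (simp add: p atom_prob_def)
  qed
  let ?s = "\<lambda>p. - log 2 (atom_prob \<mu> U (fst p)) + - log 2 (atom_prob \<mu> ?VZ (snd p)) - - log 2 (atom_prob \<mu> Z (snd p))"
  have logp: "- log 2 (atom_prob ?\<nu> ?T p) = ?s p" if "p \<in> set_pmf ?\<nu>" for p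
  proof -
    have "fst p \<in> set_pmf \<mu>" "snd p \<in> set_pmf \<mu>" using that by (auto simp: set_copy_pmf)
    then show ?thesis
      using atom_prob_pos[of "fst p" \<mu> U] atom_prob_pos[of "snd p" \<mu> ?VZ] atom_prob_pos[of "snd p" \<mu> Z]
      by (simp add: p[OF that] log_mult log_divide)
  qed
  have i1: "integrable (measure_pmf ?\<nu>) (\<lambda>p. - log 2 (atom_prob \<mu> X (fst p)))"
      "measure_pmf.expectation ?\<nu> (\<lambda>p. - log 2 (atom_prob \<mu> X (fst p))) = ent \<mu> X"
    if "finite_ent \<mu> X" for X :: "'a \<Rightarrow> 'x"
    using that integrable_map_pmf_eq[of fst ?\<nu> "\<lambda>\<omega>. - log 2 (atom_prob \<mu> X \<omega>)"]
      integral_map_pmf[of fst ?\<nu> "\<lambda>\<omega>. - log 2 (atom_prob \<mu> X \<omega>)"]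
    by (simp_all add: map_fst_copy_pmf finite_ent_def ent_def)
  have i2: "integrable (measure_pmf ?\<nu>) (\<lambda>p. - log 2 (atom_prob \<mu> X (snd p)))"
      "measure_pmf.expectation ?\<nu> (\<lambda>p. - log 2 (atom_prob \<mu> X (snd p))) = ent \<mu> X"
    if "finite_ent \<mu> X" for X :: "'a \<Rightarrow> 'x"
    using that integrable_map_pmf_eq[of snd ?\<nu> "\<lambda>\<omega>. - log 2 (atom_prob \<mu> X \<omega>)"]
      integral_map_pmf[of snd ?\<nu> "\<lambda>\<omega>. - log 2 (atom_prob \<mu> X \<omega>)"]
    by (simp_all add: map_snd_copy_pmf finite_ent_def ent_def)
  note ints = i1(1)[OF fin(1)] i2(1)[OF fin(2)] i2(1)[OF finZ]
  have "integrable (measure_pmf ?\<nu>) ?s"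
    using ints by (intro Bochner_Integration.integrable_add Bochner_Integration.integrable_diff)
  then show ?fin
    unfolding finite_ent_def
  proof (rule integrable_cong_AE_imp)
    show "AE p in measure_pmf ?\<nu>. ?s p = - log 2 (atom_prob ?\<nu> ?T p)"
      unfolding AE_measure_pmf_iff by (intro ballI logp[symmetric])
  qed simp
  have "ent ?\<nu> ?T = measure_pmf.expectation ?\<nu> ?s"
    unfolding ent_def by (intro integral_cong_AE) (auto simp: AE_measure_pmf_iff logp)
  also have "\<dots> = measure_pmf.expectation ?\<nu> (\<lambda>p. - log 2 (atom_prob \<mu> U (fst p)))
      + measure_pmf.expectation ?\<nu> (\<lambda>p. - log 2 (atom_prob \<mu> ?VZ (snd p)))
      - measure_pmf.expectation ?\<nu> (\<lambda>p. - log 2 (atom_prob \<mu> Z (snd p)))"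
    by (simp only: Bochner_Integration.integral_diff Bochner_Integration.integral_add
        Bochner_Integration.integrable_add ints)
  also have "\<dots> = ent \<mu> U + ent \<mu> ?VZ - ent \<mu> Z"
    by (simp only: i1(2)[OF fin(1)] i2(2)[OF fin(2)] i2(2)[OF finZ])
  finally show ?eq .
qed

text \<open>Variable 4 below is a copy of variable 2 over the pair of variables 0 and 1; the inequality is then
  a combination of Shannon inequalities for five variables.\<close>
lemma zhang_yeung:
  fixes \<mu> :: "'w pmf" and X :: "nat \<Rightarrow> 'w \<Rightarrow> 'b"
  defines "H S \<equiv> ent \<mu> (joint X S)"
  assumes fin: "finite_ent \<mu> (joint X {0,1,2,3})"
  shows "H {0} + H {1} - H {0,1} \<le>
      2 * (H {0,2} + H {1,2} - H {0,1,2} - H {2})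
    + (H {0,1} + H {1,2} - H {0,1,2} - H {1})
    + (H {0,1} + H {0,2} - H {0,1,2} - H {0})
    + (H {0,3} + H {1,3} - H {0,1,3} - H {3})
    + (H {2} + H {3} - H {2,3})"
proof -
  define Z where "Z = joint X {0,1}"
  define \<nu> where "\<nu> = copy_pmf \<mu> Z"
  define Y :: "nat \<Rightarrow> 'w \<times> 'w \<Rightarrow> 'b" where "Y i p = (if i = 4 then X 2 (snd p) else X i (fst p))" for i p
  define K where "K S = ent \<nu> (joint Y S)" for S
  have fin': "finite_ent \<mu> (joint X S)" if "S \<subseteq> {0,1,2,3}" for S
    using finite_ent_determines[OF determines_joint[OF that] fin] .
  \<comment> \<open>Without index 4 only the first sample enters, and its law is
    \<open>\<mu>\<close>.\<close>
  have KH: "K S = H S" if "4 \<notin> S" for S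
  proof -
    have "joint Y S p = joint X S (fst p)" for p
      using that unfolding joint_def by (intro restrict_ext) (auto simp: Y_def)
    then have "joint Y S = (\<lambda>p. joint X S (fst p))" by (rule ext)
    then have "K S = ent \<nu> (\<lambda>p. joint X S (fst p))" by (simp add: K_def)
    also have "\<dots> = H S" using ent_map_pmf[of fst \<nu> "joint X S"]
      by (simp add: \<nu>_def map_fst_copy_pmf H_def)
    finally show ?thesis .
  qed
  \<comment> \<open>The two samples agree on variables 0 and 1, so these may be read off the second
    sample; variables 0, 1, 4 then carry the same entropies as 0, 1, 2.\<close>
  have KR: "K (insert 4 S) = H (insert 2 S)" if S: "S \<subseteq> {0,1}" for S
  proof -
    have si: "same_info \<nu> (\<lambda>p. joint X (insert 2 S) (snd p)) (joint Y (insert 4 S))"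
      unfolding same_info_def
    proof (intro ballI)
      fix p q assume pq: "p \<in> set_pmf \<nu>" "q \<in> set_pmf \<nu>"
      have "X i (fst r) = X i (snd r)" if "r \<in> set_pmf \<nu>" "i \<in> S" for i r
        using that S by (auto simp: \<nu>_def set_copy_pmf Z_def joint_eq_iff)
      then have "Y i r = X i (snd r)" if "r \<in> set_pmf \<nu>" "i \<in> S" for i r
        using that S by (auto simp: Y_def)
      moreover have "Y 4 r = X 2 (snd r)" for r by (simp add: Y_def)
      ultimately show "(joint X (insert 2 S) (snd p) = joint X (insert 2 S) (snd q)) =
          (joint Y (insert 4 S) p = joint Y (insert 4 S) q)"
        using pq by (simp add: joint_eq_iff)
    qed
    have "finite_ent \<nu> (\<lambda>p. joint X (insert 2 S) (snd p))"
      using finite_ent_map_pmf[of snd \<nu> "joint X (insert 2 S)"] fin'[of "insert 2 S"] S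
      by (auto simp: \<nu>_def map_snd_copy_pmf)
    then have "K (insert 4 S) = ent \<nu> (\<lambda>p. joint X (insert 2 S) (snd p))"
      using ent_same_info[OF si] by (simp add: K_def)
    also have "\<dots> = H (insert 2 S)" using ent_map_pmf[of snd \<nu> "joint X (insert 2 S)"]
      by (simp add: \<nu>_def map_snd_copy_pmf H_def)
    finally show ?thesis .
  qed
  have siV: "same_info \<mu> (joint X {0,1,2}) (\<lambda>\<omega>. (X 2 \<omega>, Z \<omega>))"
    by (auto simp: same_info_def joint_eq_iff Z_def)
  have finV: "finite_ent \<mu> (\<lambda>\<omega>. (X 2 \<omega>, Z \<omega>))"
    using finite_ent_same_info[OF siV] fin' by simp
  have siT: "same_info \<nu> (\<lambda>(\<omega>, \<omega>'). (joint X {0,1,2,3} \<omega>, X 2 \<omega>')) (joint Y {0,1,2,3,4})"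
    by (auto simp: same_info_def joint_eq_iff Y_def)
  have UZ: "determines \<mu> (joint X {0,1,2,3}) Z"
    unfolding Z_def by (rule determines_joint) auto
  have finT: "finite_ent \<nu> (joint Y {0,1,2,3,4})"
    using copy_pmf_joint_entropy(1)[OF UZ fin finV] finite_ent_same_info[OF siT] by (simp add: \<nu>_def)
  \<comment> \<open>Here the conditional independence of the copy enters, as an equality.\<close>
  have top: "K {0,1,2,3,4} = H {0,1,2,3} + H {0,1,2} - H {0,1}"
    using copy_pmf_joint_entropy[OF UZ fin finV] ent_same_info[OF siT] ent_same_info[OF siV] fin'
    by (simp add: \<nu>_def K_def H_def Z_def)
  have sub: "K (S \<union> T) + K (S \<inter> T) \<le> K S + K T" if "S \<subseteq> {0,1,2,3,4}" "T \<subseteq> {0,1,2,3,4}" for S T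
    unfolding K_def using joint_submodular[OF finT that] .
  have kr: "K {4} = H {2}" "K {0,4} = H {0,2}" "K {1,4} = H {1,2}" "K {0,1,4} = H {0,1,2}"
    using KR[of "{}"] KR[of "{0}"] KR[of "{1}"] KR[of "{0,1}"] by (simp_all add: insert_commute)
  \<comment> \<open>Adding these twelve instances of submodularity, the one for
    \<open>{0,1,2,3}\<close> and \<open>{0,1,3,4}\<close> counted twice, gives the claim after
    substituting \<open>kr\<close> and \<open>top\<close>.\<close>
  have "K {0,3,4} + K {1,3,4} \<ge> K {0,1,3,4} + K {3,4}"
    using sub[of "{0,3,4}" "{1,3,4}"] by (simp add: insert_commute)
  moreover have "K {0,3} + K {0,4} \<ge> K {0,3,4} + K {0}"
    using sub[of "{0,3}" "{0,4}"] by (simp add: insert_commute)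
  moreover have "K {1,3} + K {1,4} \<ge> K {1,3,4} + K {1}"
    using sub[of "{1,3}" "{1,4}"] by (simp add: insert_commute)
  moreover have "K {0,2,3} + K {2,3,4} \<ge> K {0,2,3,4} + K {2,3}"
    using sub[of "{0,2,3}" "{2,3,4}"] by (simp add: insert_commute)
  moreover have "K {0,1,2,3} + K {0,1,3,4} \<ge> K {0,1,2,3,4} + K {0,1,3}"
    using sub[of "{0,1,2,3}" "{0,1,3,4}"] by (simp add: insert_commute)
  moreover have "K {0,2} + K {0,4} \<ge> K {0,2,4} + K {0}"
    using sub[of "{0,2}" "{0,4}"] by (simp add: insert_commute)
  moreover have "K {0,2,4} + K {1,2,4} \<ge> K {0,1,2,4} + K {2,4}"
    using sub[of "{0,2,4}" "{1,2,4}"] by (simp add: insert_commute)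
  moreover have "K {1,2} + K {1,4} \<ge> K {1,2,4} + K {1}"
    using sub[of "{1,2}" "{1,4}"] by (simp add: insert_commute)
  moreover have "K {0,1,3} + K {0,1,4} \<ge> K {0,1,3,4} + K {0,1}"
    using sub[of "{0,1,3}" "{0,1,4}"] by (simp add: insert_commute)
  moreover have "K {0,1,2,3} + K {0,1,2,4} \<ge> K {0,1,2,3,4} + K {0,1,2}"
    using sub[of "{0,1,2,3}" "{0,1,2,4}"] by (simp add: insert_commute)
  moreover have "K {2,4} + K {3,4} \<ge> K {2,3,4} + K {4}"
    using sub[of "{2,4}" "{3,4}"] by (simp add: insert_commute)
  moreover have "K {0,1,2,3} + K {0,2,3,4} \<ge> K {0,1,2,3,4} + K {0,2,3}"
    using sub[of "{0,1,2,3}" "{0,2,3,4}"] by (simp add: insert_commute)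
  ultimately show ?thesis
    unfolding kr top by (simp add: KH)
qed

section \<open>Four incomparable join-irreducibles\<close>

lemma entropic_iff:
  fixes h :: "'a::distrib_lattice \<Rightarrow> real"
  shows "entropic h \<longleftrightarrow> (\<exists>\<mu> :: ('a \<Rightarrow> nat) pmf.
    (\<forall>x y. same_info \<mu> (\<lambda>\<omega>. \<omega> (sup x y)) (\<lambda>\<omega>. (\<omega> x, \<omega> y))) \<and>
    (\<forall>x. finite_ent \<mu> (\<lambda>\<omega>. \<omega> x)) \<and> (\<forall>x. h x = ent \<mu> (\<lambda>\<omega>. \<omega> x)))"
proof -
  have "finite_entropy_pmf (map_pmf X \<mu>) \<and> r = entropy_pmf (map_pmf X \<mu>) \<longleftrightarrow>
      finite_ent \<mu> X \<and> r = ent \<mu> X" for r and \<mu> :: "('a \<Rightarrow> nat) pmf" and X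
    using entropy_pmf_map[of \<mu> X] by (auto simp: finite_entropy_pmf_map)
  then show ?thesis
    unfolding entropic_def same_info_iff_determines by (simp add: all_conj_distrib)
qed

lemma entropic_imp_polymatroid:
  fixes h :: "'a::distrib_lattice \<Rightarrow> real"
  assumes "entropic h"
  shows "polymatroid h"
proof -
  obtain \<mu> :: "('a \<Rightarrow> nat) pmf" where
    \<mu>: "\<forall>x y. same_info \<mu> (\<lambda>\<omega>. \<omega> (sup x y)) (\<lambda>\<omega>. (\<omega> x, \<omega> y))"
    "\<forall>x. finite_ent \<mu> (\<lambda>\<omega>. \<omega> x)" "\<forall>x. h x = ent \<mu> (\<lambda>\<omega>. \<omega> x)"
    using assms unfolding entropic_iff by blast
  note si = \<mu>(1)[rule_format] and fin = \<mu>(2)[rule_format] and h = \<mu>(3)[rule_format]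
  have det: "determines \<mu> (\<lambda>\<omega>. \<omega> x) (\<lambda>\<omega>. \<omega> y)" if "y \<le> x" for x y
  proof (rule determinesI)
    fix \<omega> \<omega>' assume \<omega>: "\<omega> \<in> set_pmf \<mu>" "\<omega>' \<in> set_pmf \<mu>" and eq: "\<omega> x = \<omega>' x"
    have "\<omega> (sup x y) = \<omega>' (sup x y) \<longleftrightarrow> (\<omega> x, \<omega> y) = (\<omega>' x, \<omega>' y)"
      using si[of x y] \<omega> unfolding same_info_def by blast
    then show "\<omega> y = \<omega>' y"
      unfolding sup_absorb1[OF that] using eq by blast
  qed
  have sub: "h (sup x y) + h (inf x y) \<le> h x + h y" for x y
  proof -
    have "finite_ent \<mu> (\<lambda>\<omega>. (\<omega> x, \<omega> y))"
      using finite_ent_same_info[OF si[of x y]] fin[of "sup x y"] by simp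
    then show ?thesis
      unfolding h ent_same_info[OF si fin, of x y] by (intro ent_submodular det fin) auto
  qed
  show ?thesis
    unfolding polymatroid_def
  proof (intro conjI allI impI)
    show "h y \<le> h x" if "y \<le> x" for x y
      unfolding h by (intro ent_determines_le det that fin)
    show "0 \<le> h x" for x unfolding h by (rule ent_nonneg)
  qed (rule sub)
qed

lemma closed_polymatroid: "closed {h :: 'a::distrib_lattice \<Rightarrow> real. polymatroid h}"
proof -
  have c: "continuous_on UNIV (\<lambda>h :: 'a \<Rightarrow> real. h x)" for x
    by (rule continuous_on_product_coordinates)
  have "closed {h :: 'a \<Rightarrow> real. y \<le> x \<longrightarrow> h y \<le> h x}" for x y
    by (cases "y \<le> x") (simp_all add: closed_Collect_le c)
  then show ?thesis
    unfolding polymatroid_def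
    by (intro closed_Collect_conj closed_Collect_all closed_Collect_le continuous_intros c)
qed

lemma entropic_zhang_yeung:
  fixes h :: "'a::distrib_lattice \<Rightarrow> real"
  assumes "entropic h"
  shows "h a + h b - h (sup a b) \<le>
      2 * (h (sup a c) + h (sup b c) - h (sup (sup a b) c) - h c)
    + (h (sup a b) + h (sup b c) - h (sup (sup a b) c) - h b)
    + (h (sup a b) + h (sup a c) - h (sup (sup a b) c) - h a)
    + (h (sup a d) + h (sup b d) - h (sup (sup a b) d) - h d)
    + (h c + h d - h (sup c d))"
proof -
  obtain \<mu> :: "('a \<Rightarrow> nat) pmf" where
    \<mu>: "\<forall>x y. same_info \<mu> (\<lambda>\<omega>. \<omega> (sup x y)) (\<lambda>\<omega>. (\<omega> x, \<omega> y))"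
    "\<forall>x. finite_ent \<mu> (\<lambda>\<omega>. \<omega> x)" "\<forall>x. h x = ent \<mu> (\<lambda>\<omega>. \<omega> x)"
    using assms unfolding entropic_iff by blast
  note si = \<mu>(1)[rule_format] and fin = \<mu>(2)[rule_format] and h = \<mu>(3)[rule_format]
  define X where "X i \<omega> = \<omega> ([a, b, c, d] ! i)" for i and \<omega> :: "'a \<Rightarrow> nat"
  have single: "same_info \<mu> (\<lambda>\<omega>. \<omega> a) (joint X {0})" "same_info \<mu> (\<lambda>\<omega>. \<omega> b) (joint X {1})"
    "same_info \<mu> (\<lambda>\<omega>. \<omega> c) (joint X {2})" "same_info \<mu> (\<lambda>\<omega>. \<omega> d) (joint X {3})"
    by (auto simp: same_info_def joint_eq_iff X_def)
  \<comment> \<open>A join carries the information of its two arguments together, so joins of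
    \<open>a\<close>, \<open>b\<close>, \<open>c\<close>, \<open>d\<close> correspond to unions of
    index sets.\<close>
  have join: "same_info \<mu> (\<lambda>\<omega>. \<omega> (sup x y)) (joint X (S \<union> T))"
    if "same_info \<mu> (\<lambda>\<omega>. \<omega> x) (joint X S)" "same_info \<mu> (\<lambda>\<omega>. \<omega> y) (joint X T)" for x y S T
    using that si[of x y] by (auto simp: same_info_def joint_eq_iff)
  note pair = join[OF single(1) single(2)] join[OF single(1) single(3)] join[OF single(1) single(4)]
    join[OF single(2) single(3)] join[OF single(2) single(4)] join[OF single(3) single(4)]
  note triple = join[OF pair(1) single(3)] join[OF pair(1) single(4)]
  note all = join[OF triple(1) single(4)]
  have "finite_ent \<mu> (joint X {0,1,2,3})"
    using finite_ent_same_info[OF all] fin by (simp add: insert_commute)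
  from zhang_yeung[OF this] show ?thesis
    using single[THEN ent_same_info, OF fin] pair[THEN ent_same_info, OF fin]
      triple[THEN ent_same_info, OF fin]
    unfolding h by (simp add: insert_commute)
qed

lemma closure_entropic_zhang_yeung:
  fixes h :: "'a::distrib_lattice \<Rightarrow> real"
  assumes "h \<in> closure {h. entropic h}"
  shows "h a + h b - h (sup a b) \<le>
      2 * (h (sup a c) + h (sup b c) - h (sup (sup a b) c) - h c)
    + (h (sup a b) + h (sup b c) - h (sup (sup a b) c) - h b)
    + (h (sup a b) + h (sup a c) - h (sup (sup a b) c) - h a)
    + (h (sup a d) + h (sup b d) - h (sup (sup a b) d) - h d)
    + (h c + h d - h (sup c d))" (is "?P h")
proof -
  have c: "continuous_on UNIV (\<lambda>h :: 'a \<Rightarrow> real. h x)" for x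
    by (rule continuous_on_product_coordinates)
  have "closed {h. ?P h}"
    by (intro closed_Collect_le continuous_intros c)
  moreover have "{h. entropic h} \<subseteq> {h. ?P h}"
    using entropic_zhang_yeung by blast
  ultimately have "closure {h. entropic h} \<subseteq> {h. ?P h}" by (rule closure_minimal[rotated])
  then show ?thesis using assms by blast
qed

text \<open>Distributivity splits \<open>j\<close> into \<open>inf j x\<close> and
  \<open>inf j y\<close>, and irreducibility selects one part. So
  \<open>x \<mapsto> (j \<le> x)\<close> is a lattice homomorphism to the truth values.\<close>

lemma join_irreducible_le_sup_iff:
  assumes "join_irreducible j"
  shows "j \<le> sup x y \<longleftrightarrow> j \<le> x \<or> j \<le> y"
proof
  assume "j \<le> sup x y"
  then have "j = sup (inf j x) (inf j y)"
    by (metis inf.absorb1 inf_sup_distrib1)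
  then have "j = inf j x \<or> j = inf j y"
    using assms unfolding join_irreducible_def by blast
  then show "j \<le> x \<or> j \<le> y" by (metis inf.cobounded2)
qed (auto intro: le_supI1 le_supI2)

lemma order_dimension_le_iff:
  "order_dimension TYPE('a::{finite,distrib_lattice}) \<le> k \<longleftrightarrow>
    (\<forall>A :: 'a set. A \<subseteq> {x. join_irreducible x} \<longrightarrow> is_antichain A \<longrightarrow> card A \<le> k)"
proof -
  let ?S = "{card A | A :: 'a set. A \<subseteq> {x. join_irreducible x} \<and> is_antichain A}"
  have "?S \<subseteq> card ` (UNIV :: 'a set set)" by auto
  then have "finite ?S" by (rule finite_subset) simp
  moreover have "card ({} :: 'a set) \<in> ?S" unfolding is_antichain_def by blast
  ultimately show ?thesis
    unfolding order_dimension_def by (subst Max_le_iff) auto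
qed

text \<open>A rank function on the Boolean lattice with four atoms. Raising the pair of
  \<open>r\<close> and \<open>s\<close> from 3 to 4 makes all five terms on the right of the
  Zhang-Yeung inequality vanish, while its left side is 1.\<close>

definition zy_violator :: "bool \<Rightarrow> bool \<Rightarrow> bool \<Rightarrow> bool \<Rightarrow> real" where
  "zy_violator p q r s =
    (let n = of_bool p + of_bool q + of_bool r + of_bool s :: nat in
     if n = 0 then 0 else if n = 1 then 2 else if n = 2 \<and> \<not> (r \<and> s) then 3 else 4)"

lemma zy_violator_nonneg: "0 \<le> zy_violator p q r s"
  by (simp add: zy_violator_def Let_def)

lemma zy_violator_mono:
  "(p \<longrightarrow> p') \<Longrightarrow> (q \<longrightarrow> q') \<Longrightarrow> (r \<longrightarrow> r') \<Longrightarrow> (s \<longrightarrow> s') \<Longrightarrow> zy_violator p q r s \<le> zy_violator p' q' r' s'"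
  by (cases p; cases q; cases r; cases s; cases p'; cases q'; cases r'; cases s'; simp add: zy_violator_def)

lemma zy_violator_submodular:
  "zy_violator (p \<or> p') (q \<or> q') (r \<or> r') (s \<or> s') + zy_violator (p \<and> p') (q \<and> q') (r \<and> r') (s \<and> s')
    \<le> zy_violator p q r s + zy_violator p' q' r' s'"
  by (cases p; cases q; cases r; cases s; cases p'; cases q'; cases r'; cases s'; simp add: zy_violator_def)

text \<open>Primality makes the pullback of \<open>zy_violator\<close> a polymatroid, and
  incomparability ensures that each of \<open>a\<close>, \<open>b\<close>, \<open>c\<close>,
  \<open>d\<close> is sent to a single atom.\<close>

lemma not_shannon_lattice_antichain4:
  fixes a b c d :: "'a::{finite,distrib_lattice}"
  assumes ji: "join_irreducible a" "join_irreducible b" "join_irreducible c" "join_irreducible d"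
    and nle: "\<not> a \<le> b" "\<not> a \<le> c" "\<not> a \<le> d" "\<not> b \<le> a" "\<not> b \<le> c" "\<not> b \<le> d"
      "\<not> c \<le> a" "\<not> c \<le> b" "\<not> c \<le> d" "\<not> d \<le> a" "\<not> d \<le> b" "\<not> d \<le> c"
  shows "\<not> shannon_lattice TYPE('a)"
proof
  assume sh: "shannon_lattice TYPE('a)"
  define h where "h x = zy_violator (a \<le> x) (b \<le> x) (c \<le> x) (d \<le> x)" for x
  note prime = ji[THEN join_irreducible_le_sup_iff]
  have "polymatroid h"
    unfolding polymatroid_def
  proof (intro conjI allI impI)
    show "h (sup x y) + h (inf x y) \<le> h x + h y" for x y
      unfolding h_def prime le_inf_iff by (rule zy_violator_submodular)
    show "h y \<le> h x" if "y \<le> x" for x y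
      unfolding h_def using that by (intro zy_violator_mono) (auto intro: order_trans)
  qed (simp add: h_def zy_violator_nonneg)
  then have "h \<in> closure {h. entropic h}"
    using sh unfolding shannon_lattice_def by blast
  from closure_entropic_zhang_yeung[OF this, of a b c d] show False
    by (simp add: h_def prime nle zy_violator_def)
qed

lemma shannon_lattice_imp_order_dimension_le_3:
  assumes "shannon_lattice TYPE('a::{finite,distrib_lattice})"
  shows "order_dimension TYPE('a) \<le> 3"
  unfolding order_dimension_le_iff
proof (intro allI impI, rule ccontr)
  fix A :: "'a set"
  assume A: "A \<subseteq> {x. join_irreducible x}" "is_antichain A" and "\<not> card A \<le> 3"
  then obtain B where B: "B \<subseteq> A" "card B = 4"
    using obtain_subset_with_card_n[of 4 A] by auto
  have "card B = Suc (Suc (Suc (Suc 0)))" using B(2) by simp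
  then obtain a b c d where abcd: "B = {a, b, c, d}" "distinct [a, b, c, d]"
    by (elim card_Suc_eq[THEN iffD1, elim_format] exE conjE) auto
  then have in_A: "a \<in> A" "b \<in> A" "c \<in> A" "d \<in> A" using B by auto
  have nle: "\<not> x \<le> y" if "x \<in> A" "y \<in> A" "x \<noteq> y" for x y
    using A(2) that unfolding is_antichain_def by blast
  have "\<not> shannon_lattice TYPE('a)"
    by (rule not_shannon_lattice_antichain4[of a b c d])
      (use in_A A(1) abcd(2) nle in auto)
  then show False using assms by contradiction
qed

section \<open>Dilworth's theorem\<close>

lemma finite_chain_has_greatest:
  fixes S :: "'a::order set"
  assumes "finite S" "S \<noteq> {}" "\<forall>x\<in>S. \<forall>y\<in>S. x \<le> y \<or> y \<le> x"
  shows "\<exists>g\<in>S. \<forall>x\<in>S. x \<le> g"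
  using finite_has_maximal[OF assms(1,2)] assms(3) by metis

text \<open>Galvin's induction: remove a maximal element \<open>m\<close> and split the rest into
  \<open>w\<close> chains, where \<open>w\<close> is its width. Either \<open>m\<close> extends part
  of one of them, or it enlarges an antichain and may form a chain of its own.\<close>

theorem dilworth:
  fixes P :: "'a::order set"
  assumes "finite P" "\<And>A. A \<subseteq> P \<Longrightarrow> is_antichain A \<Longrightarrow> card A \<le> k"
  shows "\<exists>f. (\<forall>x\<in>P. f x < k) \<and> (\<forall>x\<in>P. \<forall>y\<in>P. f x = f y \<longrightarrow> x \<le> y \<or> y \<le> x)"
  using assms
proof (induction "card P" arbitrary: P k rule: less_induct)
  case less
  show ?case
  proof (cases "P = {}")
    case False
    obtain m where m: "m \<in> P" "\<And>y. y \<in> P \<Longrightarrow> m \<le> y \<Longrightarrow> m = y"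
      using finite_has_maximal[OF less.prems(1) False] by blast
    define P' where "P' = P - {m}"
    have finP': "finite P'" and P'P: "P' \<subseteq> P" using less.prems(1) by (auto simp: P'_def)
    have cardP': "card P' < card P"
      unfolding P'_def using less.prems(1) m(1) by (rule card_Diff1_less)
    let ?AC = "{A. A \<subseteq> P' \<and> is_antichain A}"
    have finAC: "finite (card ` ?AC)" using finP' by simp
    have neAC: "card ` ?AC \<noteq> {}" by (auto simp: is_antichain_def)
    define w where "w = Max (card ` ?AC)"
    have w_ge: "card A \<le> w" if "A \<subseteq> P'" "is_antichain A" for A
      unfolding w_def using finAC that by (intro Max_ge) auto
    obtain A0 where A0: "A0 \<subseteq> P'" "is_antichain A0" "card A0 = w"
      using Max_in[OF finAC neAC] unfolding w_def by auto
    have wk: "w \<le> k" using less.prems(2)[of A0] A0 P'P by auto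
    obtain f where f: "\<forall>x\<in>P'. f x < w" "\<forall>x\<in>P'. \<forall>y\<in>P'. f x = f y \<longrightarrow> x \<le> y \<or> y \<le> x"
      using less.hyps[OF cardP' finP' w_ge] by blast
    have meets: "\<exists>x\<in>A. f x = i" if A: "A \<subseteq> P'" "is_antichain A" "card A = w" and i: "i < w" for A i
    proof -
      have "inj_on f A"
      proof (rule inj_onI)
        fix x y assume "x \<in> A" "y \<in> A" "f x = f y"
        then show "x = y" using f(2) A(1,2) unfolding is_antichain_def by (metis subsetD)
      qed
      then have "card (f ` A) = card {..<w}" using A(3) by (simp add: card_image)
      moreover have "f ` A \<subseteq> {..<w}" using f(1) A(1) by auto
      ultimately have "f ` A = {..<w}" by (intro card_subset_eq) auto
      then show ?thesis using i by (metis imageE lessThan_iff)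
    qed
    \<comment> \<open>\<open>M\<close> collects the points on antichains of full size
      \<open>w\<close>; \<open>a i\<close> below is the greatest of them in chain
      \<open>i\<close>.\<close>
    define M where "M = {x \<in> P'. \<exists>A. A \<subseteq> P' \<and> is_antichain A \<and> card A = w \<and> x \<in> A}"
    have "\<exists>g\<in>{x \<in> M. f x = i}. \<forall>x\<in>{x \<in> M. f x = i}. x \<le> g" if i: "i < w" for i
    proof (rule finite_chain_has_greatest)
      show "{x \<in> M. f x = i} \<noteq> {}"
        using meets[OF A0 i] A0 unfolding M_def by blast
    qed (use finP' f(2) in \<open>auto simp: M_def\<close>)
    then obtain a where a: "\<And>i. i < w \<Longrightarrow> a i \<in> M \<and> f (a i) = i"
      and a_max: "\<And>i x. i < w \<Longrightarrow> x \<in> M \<Longrightarrow> f x = i \<Longrightarrow> x \<le> a i"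
      by (metis (mono_tags, lifting) mem_Collect_eq)
    \<comment> \<open>A full antichain through \<open>a j\<close> meets chain \<open>i\<close> in
      some \<open>x \<le> a i \<le> a j\<close>, which forces \<open>x = a j\<close>.\<close>
    have a_anti: "i = j" if ij: "i < w" "j < w" "a i \<le> a j" for i j
    proof -
      obtain A where A: "A \<subseteq> P'" "is_antichain A" "card A = w" "a j \<in> A"
        using a[OF ij(2)] by (auto simp: M_def)
      obtain x where x: "x \<in> A" "f x = i" using meets[OF A(1-3) ij(1)] by blast
      have "x \<le> a i" using x A by (intro a_max ij) (auto simp: M_def)
      then have "x \<le> a j" using ij(3) by (rule order_trans)
      then have "x = a j" using A(2,4) x(1) by (auto simp: is_antichain_def)
      then show ?thesis using x(2) a[OF ij(2)] by simp
    qed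
    show ?thesis
    proof (cases "\<exists>i<w. a i \<le> m")
      case True
      then obtain i where i: "i < w" "a i \<le> m" by blast
      define K where "K = insert m {z \<in> P'. f z = i \<and> z \<le> a i}"
      have chainK: "x \<le> y \<or> y \<le> x" if "x \<in> K" "y \<in> K" for x y
        using that f(2) i(2) unfolding K_def by (auto intro: order_trans)
      have "card (P - K) < card P"
        using less.prems(1) m(1) by (intro psubset_card_mono) (auto simp: K_def)
      \<comment> \<open>An antichain of size \<open>w\<close> avoiding \<open>K\<close> would meet
        chain \<open>i\<close> in a point of \<open>M\<close>, hence below \<open>a i\<close> and
        inside \<open>K\<close>.\<close>
      moreover have "card A \<le> w - 1" if A: "A \<subseteq> P - K" "is_antichain A" for A
      proof (rule ccontr)
        assume "\<not> card A \<le> w - 1"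
        have AP': "A \<subseteq> P'" using A(1) by (auto simp: P'_def K_def)
        with \<open>\<not> card A \<le> w - 1\<close> have cA: "card A = w" using w_ge[OF AP' A(2)] by simp
        obtain x where x: "x \<in> A" "f x = i" using meets[OF AP' A(2) cA i(1)] by blast
        have "x \<le> a i" using x A AP' cA by (intro a_max i) (auto simp: M_def)
        then show False using x A(1) AP' by (auto simp: K_def)
      qed
      ultimately obtain g where g: "\<forall>x\<in>P - K. g x < w - 1"
          "\<forall>x\<in>P - K. \<forall>y\<in>P - K. g x = g y \<longrightarrow> x \<le> y \<or> y \<le> x"
        using less.hyps[of "P - K" "w - 1"] less.prems(1) by blast
      show ?thesis
      proof (intro exI[of _ "\<lambda>x. if x \<in> K then w - 1 else g x"] conjI ballI impI)
        fix x assume "x \<in> P"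
        then have "x \<notin> K \<Longrightarrow> g x < w - 1" using g(1) by blast
        then show "(if x \<in> K then w - 1 else g x) < k" using i(1) wk by (cases "x \<in> K") auto
      next
        fix x y assume "x \<in> P" "y \<in> P"
          "(if x \<in> K then w - 1 else g x) = (if y \<in> K then w - 1 else g y)"
        then show "x \<le> y \<or> y \<le> x"
          using g chainK by (cases "x \<in> K"; cases "y \<in> K") (auto, (metis DiffI less_irrefl)+)
      qed
    next
      case False
      \<comment> \<open>Maximality of \<open>m\<close> excludes \<open>m \<le> a j\<close>, so there
        are \<open>w + 1\<close> incomparable elements and colour \<open>w\<close> is free for
        \<open>m\<close>.\<close>
      have "is_antichain (insert m (a ` {..<w}))"
        unfolding is_antichain_def
      proof (intro ballI impI)
        fix x y assume xy: "x \<in> insert m (a ` {..<w})" "y \<in> insert m (a ` {..<w})" "x \<le> y"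
        have "a j \<in> P" if "j < w" for j using a[OF that] P'P by (auto simp: M_def)
        then show "x = y" using xy False m(2) by (auto, metis a_anti)
      qed
      moreover have "insert m (a ` {..<w}) \<subseteq> P"
        using a P'P m(1) by (auto simp: M_def)
      ultimately have "card (insert m (a ` {..<w})) \<le> k" by (rule less.prems(2)[rotated])
      moreover have "card (insert m (a ` {..<w})) = Suc w"
      proof -
        have "m \<notin> a ` {..<w}" using a by (auto simp: M_def P'_def)
        moreover have "inj_on a {..<w}" using a by (intro inj_onI) (metis lessThan_iff)
        ultimately show ?thesis by (simp add: card_image)
      qed
      ultimately have "w < k" by simp
      show ?thesis
      proof (intro exI[of _ "\<lambda>x. if x = m then w else f x"] conjI ballI impI)
        fix x assume "x \<in> P"
        then show "(if x = m then w else f x) < k"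
          using f(1) \<open>w < k\<close> by (auto simp: P'_def intro: less_trans)
      next
        fix x y assume xy: "x \<in> P" "y \<in> P" "(if x = m then w else f x) = (if y = m then w else f y)"
        have "f z < w" if "z \<in> P" "z \<noteq> m" for z using f(1) that by (simp add: P'_def)
        moreover have "f x = f y \<longrightarrow> x \<le> y \<or> y \<le> x" if "x \<noteq> m" "y \<noteq> m"
          using f(2) that xy by (simp add: P'_def)
        ultimately show "x \<le> y \<or> y \<le> x"
          using xy by (metis less_irrefl order_refl)
      qed
    qed
  qed simp
qed

section \<open>Staircases\<close>

definition additive_subgroup :: "'g::ab_group_add set \<Rightarrow> bool" where
  "additive_subgroup K \<longleftrightarrow> 0 \<in> K \<and> (\<forall>x\<in>K. \<forall>y\<in>K. x - y \<in> K)"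

lemma additive_subgroup_add: "additive_subgroup K \<Longrightarrow> x \<in> K \<Longrightarrow> y \<in> K \<Longrightarrow> x + y \<in> K"
  unfolding additive_subgroup_def by (metis diff_0 diff_minus_eq_add)

text \<open>Each \<open>e u\<close> is a difference of consecutive partial sums. The last of these,
  at \<open>m\<close>, is the total sum and vanishes, so leaving it out loses nothing.\<close>

lemma partial_sums_vanish_below_iff:
  fixes e :: "'l \<Rightarrow> 'b::ab_group_add" and I :: "'l \<Rightarrow> nat"
  assumes fin: "finite S" and inj: "inj_on I S" and m: "m \<in> S" "\<And>u. u \<in> S \<Longrightarrow> I u \<le> I m"
    and sum0: "(\<Sum>u\<in>S. e u) = 0"
  shows "(\<forall>u\<in>S. I u < i \<longrightarrow> e u = 0) \<longleftrightarrow> (\<forall>t\<in>S - {m}. I t < i \<longrightarrow> (\<Sum>u | u \<in> S \<and> I u \<le> I t. e u) = 0)"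
proof
  assume *: "\<forall>u\<in>S. I u < i \<longrightarrow> e u = 0"
  show "\<forall>t\<in>S - {m}. I t < i \<longrightarrow> (\<Sum>u | u \<in> S \<and> I u \<le> I t. e u) = 0"
    using * by (auto intro!: sum.neutral)
next
  assume *: "\<forall>t\<in>S - {m}. I t < i \<longrightarrow> (\<Sum>u | u \<in> S \<and> I u \<le> I t. e u) = 0"
  have "u \<in> S \<Longrightarrow> I u < i \<Longrightarrow> e u = 0" for u
  proof (induction "I u" arbitrary: u rule: less_induct)
    case less
    have "(\<Sum>v | v \<in> S \<and> I v \<le> I u. e v) = 0"
    proof (cases "u = m")
      case True
      then have "{v. v \<in> S \<and> I v \<le> I u} = S" using m by auto
      then show ?thesis using sum0 by simp
    qed (use * less.prems in auto)
    moreover have "{v. v \<in> S \<and> I v \<le> I u} = insert u {v. v \<in> S \<and> I v < I u}"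
      using less.prems(1) inj by (auto simp: inj_on_def order_le_less)
    ultimately have "e u + (\<Sum>v | v \<in> S \<and> I v < I u. e v) = 0"
      using fin by simp
    moreover have "(\<Sum>v | v \<in> S \<and> I v < I u. e v) = 0"
      using less by (intro sum.neutral) auto
    ultimately show ?case by simp
  qed
  then show "\<forall>u\<in>S. I u < i \<longrightarrow> e u = 0" by blast
qed

text \<open>Along a staircase \<open>J\<close> decreases as \<open>I\<close> increases, so \<open>Max (J ` {u \<in> S. I t < I u})\<close> is the value
  of \<open>J\<close> at the successor of \<open>t\<close>.\<close>
lemma partial_sums_vanish_above_iff:
  fixes e :: "'l \<Rightarrow> 'b::ab_group_add" and I J :: "'l \<Rightarrow> nat"
  assumes fin: "finite S" and inj: "inj_on I S" and m: "m \<in> S" "\<And>u. u \<in> S \<Longrightarrow> I u \<le> I m"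
    and anti: "\<And>s u. s \<in> S \<Longrightarrow> u \<in> S \<Longrightarrow> I s < I u \<Longrightarrow> J u < J s"
    and sum0: "(\<Sum>u\<in>S. e u) = 0"
  shows "(\<forall>u\<in>S. J u < j \<longrightarrow> e u = 0) \<longleftrightarrow>
    (\<forall>t\<in>S - {m}. Max (J ` {u \<in> S. I t < I u}) < j \<longrightarrow> (\<Sum>u | u \<in> S \<and> I u \<le> I t. e u) = 0)"
proof -
  \<comment> \<open>Since the total vanishes, partial sums may be traded for tail sums; these are
    suited to \<open>J\<close>, which decreases along \<open>S\<close>.\<close>
  have compl: "(\<Sum>u | u \<in> S \<and> I u \<le> I t. e u) = 0 \<longleftrightarrow> (\<Sum>u | u \<in> S \<and> I t < I u. e u) = 0" for t
  proof -
    have "S = {u. u \<in> S \<and> I u \<le> I t} \<union> {u. u \<in> S \<and> I t < I u}" by auto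
    then have "(\<Sum>u\<in>S. e u) = (\<Sum>u\<in>{u. u \<in> S \<and> I u \<le> I t} \<union> {u. u \<in> S \<and> I t < I u}. e u)" by simp
    also have "\<dots> = (\<Sum>u | u \<in> S \<and> I u \<le> I t. e u) + (\<Sum>u | u \<in> S \<and> I t < I u. e u)"
      using fin by (intro sum.union_disjoint) auto
    finally show ?thesis using sum0 by auto
  qed
  show ?thesis
    unfolding compl
  proof
    assume *: "\<forall>u\<in>S. J u < j \<longrightarrow> e u = 0"
    show "\<forall>t\<in>S - {m}. Max (J ` {u \<in> S. I t < I u}) < j \<longrightarrow> (\<Sum>u | u \<in> S \<and> I t < I u. e u) = 0"
    proof (intro ballI impI sum.neutral)
      fix t u assume "Max (J ` {u \<in> S. I t < I u}) < j" and u: "u \<in> {u. u \<in> S \<and> I t < I u}"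
      moreover have "J u \<le> Max (J ` {u \<in> S. I t < I u})"
        using u fin by (intro Max_ge) auto
      ultimately show "e u = 0" using * by auto
    qed
  next
    assume *: "\<forall>t\<in>S - {m}. Max (J ` {u \<in> S. I t < I u}) < j \<longrightarrow> (\<Sum>u | u \<in> S \<and> I t < I u. e u) = 0"
    have "u \<in> S \<Longrightarrow> J u < j \<Longrightarrow> e u = 0" for u
    proof (induction "J u" arbitrary: u rule: less_induct)
      case less
      have later: "(\<Sum>v | v \<in> S \<and> I u < I v. e v) = 0"
        using less anti by (intro sum.neutral) force
      have "e u + (\<Sum>v | v \<in> S \<and> I u < I v. e v) = 0"
      proof (cases "{t \<in> S. I t < I u} = {}")
        case True
        then have "S = insert u {v. v \<in> S \<and> I u < I v}"
          using less.prems(1) inj by (auto simp: inj_on_def) (metis linorder_neqE_nat)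
        then have "(\<Sum>v\<in>S. e v) = (\<Sum>v\<in>insert u {v. v \<in> S \<and> I u < I v}. e v)" by simp
        then show ?thesis using sum0 fin by simp
      next
        case False
        then have "Max (I ` {t \<in> S. I t < I u}) \<in> I ` {t \<in> S. I t < I u}"
          using fin by (intro Max_in) auto
        \<comment> \<open>\<open>t\<close> is the predecessor of \<open>u\<close>: its tail sum is
          that of \<open>u\<close> with \<open>e u\<close> added, and its level does not exceed
          \<open>J u\<close>.\<close>
        then obtain t where t: "t \<in> S" "I t < I u" "I t = Max (I ` {t \<in> S. I t < I u})" by auto
        have tmax: "I v \<le> I t" if "v \<in> S" "I v < I u" for v
          unfolding t(3) using that fin by (intro Max_ge) auto
        have eq: "{v \<in> S. I t < I v} = insert u {v. v \<in> S \<and> I u < I v}"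
          using less.prems(1) t inj tmax by (auto simp: inj_on_def) (metis leD linorder_neqE_nat)
        have "J v \<le> J u" if "v \<in> insert u {v. v \<in> S \<and> I u < I v}" for v
          using that anti less.prems(1) by (auto intro: less_imp_le)
        then have "Max (J ` {v \<in> S. I t < I v}) \<le> J u"
          unfolding eq using fin by (subst Max_le_iff) auto
        moreover have "t \<noteq> m" using t(2) m(2)[OF less.prems(1)] by auto
        ultimately have "(\<Sum>v | v \<in> S \<and> I t < I v. e v) = 0"
          using * t(1) less.prems(2) by auto
        then show ?thesis unfolding eq using fin by simp
      qed
      then show ?case using later by simp
    qed
    then show "\<forall>u\<in>S. J u < j \<longrightarrow> e u = 0" by blast
  qed
qed

text \<open>Keeping \<open>I t\<close> and taking \<open>J\<close> from the successor of
  \<open>t\<close> turns outer corners of the staircase into inner ones. A quadrant holds one inner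
  corner fewer than outer corners, unless it holds no outer corner.\<close>

lemma card_staircase_step:
  fixes I J :: "'l \<Rightarrow> nat"
  assumes fin: "finite S" and inj: "inj_on I S" and m: "m \<in> S" "\<And>u. u \<in> S \<Longrightarrow> I u \<le> I m"
    and anti: "\<And>s u. s \<in> S \<Longrightarrow> u \<in> S \<Longrightarrow> I s < I u \<Longrightarrow> J u < J s"
  shows "card {t \<in> S - {m}. i \<le> I t \<and> j \<le> Max (J ` {u \<in> S. I t < I u})}
      + of_bool (\<exists>s\<in>S. i \<le> I s \<and> j \<le> J s) = card {s \<in> S. i \<le> I s \<and> j \<le> J s}"
proof -
  let ?S = "{s \<in> S. i \<le> I s \<and> j \<le> J s}"
  let ?S' = "{t \<in> S - {m}. i \<le> I t \<and> j \<le> Max (J ` {u \<in> S. I t < I u})}"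
  have next_in: "\<exists>u\<in>?S. I t < I u \<and> t \<in> ?S" if t: "t \<in> ?S'" for t
  proof -
    have "I t < I m" using t m inj by (auto simp: inj_on_def order_le_less)
    then have "Max (J ` {u \<in> S. I t < I u}) \<in> J ` {u \<in> S. I t < I u}"
      using fin m(1) by (intro Max_in) auto
    then obtain u where u: "u \<in> S" "I t < I u" "J u = Max (J ` {u \<in> S. I t < I u})" by auto
    then have "j \<le> J u" using t by auto
    moreover have "J u < J t" using t u(1,2) by (intro anti) auto
    ultimately show ?thesis using t u by (intro bexI[of _ u]) auto
  qed
  show ?thesis
  proof (cases "?S = {}")
    case True
    then have "?S' = {}" using next_in by blast
    then have "card ?S' = 0" "card ?S = 0" using True by (metis card.empty)+
    moreover have "\<not> (\<exists>s\<in>S. i \<le> I s \<and> j \<le> J s)" using True by blast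
    ultimately show ?thesis by simp
  next
    case False
    then have "Max (I ` ?S) \<in> I ` ?S" using fin by (intro Max_in) auto
    then obtain z where z: "z \<in> ?S" "I z = Max (I ` ?S)" by auto
    have zmax: "I v \<le> I z" if "v \<in> ?S" for v
      unfolding z(2) using that fin by (intro Max_ge) auto
    have "?S' = ?S - {z}"
    proof (intro set_eqI iffI)
      fix t assume "t \<in> ?S'"
      then show "t \<in> ?S - {z}" using next_in zmax by fastforce
    next
      fix t assume t: "t \<in> ?S - {z}"
      have "I t < I z" using t zmax[of t] z(1) inj by (auto simp: inj_on_def order_le_less)
      moreover have "J z \<le> Max (J ` {u \<in> S. I t < I u})"
        using calculation z(1) fin by (intro Max_ge) auto
      moreover have "t \<noteq> m" using calculation(1) m(2)[of z] z(1) by auto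
      ultimately show "t \<in> ?S'" using t z(1) by auto
    qed
    then have "card ?S' + 1 = card ?S"
      using z(1) fin by (metis (no_types, lifting) Suc_eq_plus1 card_Suc_Diff1 finite_Collect_conjI finite_subset mem_Collect_eq subsetI)
    moreover have "\<exists>s\<in>S. i \<le> I s \<and> j \<le> J s" using False by blast
    ultimately show ?thesis by simp
  qed
qed

section \<open>Two flags in coordinates\<close>

text \<open>A frame describes two descending flags \<open>A\<close>, \<open>B\<close> of subgroups of \<open>K\<close> by coordinates:
  \<open>A i\<close> (\<open>B j\<close>) is cut out by the vanishing of the coordinates \<open>t\<close> with \<open>I t < i\<close> (\<open>J t < j\<close>).\<close>
definition frame :: "'g::ab_group_add set \<Rightarrow> (nat \<Rightarrow> 'g set) \<Rightarrow> (nat \<Rightarrow> 'g set) \<Rightarrow>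
    'l set \<Rightarrow> ('l \<Rightarrow> nat) \<Rightarrow> ('l \<Rightarrow> nat) \<Rightarrow> ('g \<Rightarrow> 'l \<Rightarrow> 'b::{finite,ab_group_add}) \<Rightarrow> bool" where
  "frame K A B T I J \<tau> \<longleftrightarrow> finite T \<and> finite K \<and> additive_subgroup K \<and> card K = CARD('b) ^ card T \<and>
    (\<forall>x\<in>K. \<forall>y\<in>K. \<forall>t. \<tau> (x - y) t = \<tau> x t - \<tau> y t) \<and>
    (\<forall>x\<in>K. (\<forall>t\<in>T. \<tau> x t = 0) \<longrightarrow> x = 0) \<and>
    (\<forall>i. \<forall>x\<in>K. x \<in> A i \<longleftrightarrow> (\<forall>t\<in>T. I t < i \<longrightarrow> \<tau> x t = 0)) \<and>
    (\<forall>j. \<forall>x\<in>K. x \<in> B j \<longleftrightarrow> (\<forall>t\<in>T. J t < j \<longrightarrow> \<tau> x t = 0))"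

text \<open>In a frame this is the exponent of the order of
  \<open>A i \<inter> B j \<inter> K\<close>.\<close>

definition corner_count :: "'l set \<Rightarrow> ('l \<Rightarrow> nat) \<Rightarrow> ('l \<Rightarrow> nat) \<Rightarrow> nat \<Rightarrow> nat \<Rightarrow> nat" where
  "corner_count T I J i j = card {t \<in> T. i \<le> I t \<and> j \<le> J t}"

text \<open>Inclusion-exclusion: the mixed second difference of the count is the number of
  coordinates located exactly at \<open>(i, j)\<close>.\<close>

lemma corner_count_rec:
  assumes "finite T"
  shows "corner_count T I J i j + corner_count T I J (Suc i) (Suc j) =
    card {t \<in> T. I t = i \<and> J t = j} + corner_count T I J (Suc i) j + corner_count T I J i (Suc j)"
proof -
  let ?X = "{t \<in> T. Suc i \<le> I t \<and> j \<le> J t}" and ?Y = "{t \<in> T. i \<le> I t \<and> Suc j \<le> J t}"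
  have eq: "{t \<in> T. i \<le> I t \<and> j \<le> J t} = {t \<in> T. I t = i \<and> J t = j} \<union> (?X \<union> ?Y)" by auto
  have "corner_count T I J i j = card {t \<in> T. I t = i \<and> J t = j} + card (?X \<union> ?Y)"
    unfolding corner_count_def eq using assms by (intro card_Un_disjoint) auto
  moreover have "card ?X + card ?Y = card (?X \<union> ?Y) + card (?X \<inter> ?Y)"
    using assms by (intro card_Un_Int) auto
  moreover have "?X \<inter> ?Y = {t \<in> T. Suc i \<le> I t \<and> Suc j \<le> J t}" by auto
  ultimately show ?thesis unfolding corner_count_def by simp
qed

text \<open>The kernel condition gives injectivity, and equal finite cardinalities give the
  rest.\<close>

lemma frame_bij:
  fixes \<tau> :: "'g::ab_group_add \<Rightarrow> 'l \<Rightarrow> 'b::{finite,ab_group_add}"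
  assumes "frame K A B T I J \<tau>"
  shows "bij_betw (\<lambda>x. restrict (\<tau> x) T) K (T \<rightarrow>\<^sub>E UNIV)"
proof -
  let ?r = "\<lambda>x. restrict (\<tau> x) T"
  have inj: "inj_on ?r K"
  proof (rule inj_onI)
    fix x y assume xy: "x \<in> K" "y \<in> K" "?r x = ?r y"
    have "\<tau> (x - y) t = 0" if "t \<in> T" for t
    proof -
      have "\<tau> x t = \<tau> y t" using fun_cong[OF xy(3), of t] that by simp
      then show ?thesis using assms xy(1,2) by (simp add: frame_def)
    qed
    moreover have "x - y \<in> K" using assms xy by (simp add: frame_def additive_subgroup_def)
    ultimately have "x - y = 0" using assms unfolding frame_def by blast
    then show "x = y" by simp
  qed
  have "finite (T \<rightarrow>\<^sub>E (UNIV :: 'b set))"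
    using assms by (intro finite_PiE) (auto simp: frame_def)
  moreover have "?r ` K \<subseteq> T \<rightarrow>\<^sub>E UNIV" by auto
  moreover have "card (?r ` K) = card (T \<rightarrow>\<^sub>E (UNIV :: 'b set))"
    using assms by (simp add: card_image[OF inj] card_funcsetE frame_def)
  ultimately have "?r ` K = T \<rightarrow>\<^sub>E UNIV" by (rule card_subset_eq)
  then show ?thesis using inj by (simp add: bij_betw_def)
qed

lemma frame_card_Int:
  fixes \<tau> :: "'g::ab_group_add \<Rightarrow> 'l \<Rightarrow> 'b::{finite,ab_group_add}"
  assumes F: "frame K A B T I J \<tau>"
  shows "card (A i \<inter> B j \<inter> K) = CARD('b) ^ corner_count T I J i j"
proof -
  let ?r = "\<lambda>x. restrict (\<tau> x) T"
  \<comment> \<open>In coordinates the intersection is a box: killed coordinates are confined to 0,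
    the others are free.\<close>
  define V where "V t = (if I t < i \<or> J t < j then {0} else (UNIV :: 'b set))" for t
  have finT: "finite T" using F by (simp add: frame_def)
  have eq: "A i \<inter> B j \<inter> K = {x \<in> K. ?r x \<in> Pi\<^sub>E T V}"
  proof -
    have "x \<in> A i \<inter> B j \<longleftrightarrow> ?r x \<in> Pi\<^sub>E T V" if "x \<in> K" for x
    proof -
      have "x \<in> A i \<inter> B j \<longleftrightarrow> (\<forall>t\<in>T. I t < i \<or> J t < j \<longrightarrow> \<tau> x t = 0)"
        using F that by (auto simp: frame_def)
      also have "\<dots> \<longleftrightarrow> ?r x \<in> Pi\<^sub>E T V" by (auto simp: V_def PiE_iff)
      finally show ?thesis .
    qed
    then show ?thesis by blast
  qed
  have sub: "Pi\<^sub>E T V \<subseteq> T \<rightarrow>\<^sub>E UNIV" by (intro PiE_mono) simp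
  have "?r ` {x \<in> K. ?r x \<in> Pi\<^sub>E T V} = Pi\<^sub>E T V"
  proof (intro equalityI subsetI)
    fix f assume f: "f \<in> Pi\<^sub>E T V"
    then have "f \<in> ?r ` K" using frame_bij[OF F] sub by (auto simp: bij_betw_def)
    then show "f \<in> ?r ` {x \<in> K. ?r x \<in> Pi\<^sub>E T V}" using f by auto
  qed auto
  moreover have "inj_on ?r {x \<in> K. ?r x \<in> Pi\<^sub>E T V}"
    using frame_bij[OF F] unfolding bij_betw_def by (auto intro: inj_on_subset)
  ultimately have "bij_betw ?r {x \<in> K. ?r x \<in> Pi\<^sub>E T V} (Pi\<^sub>E T V)"
    by (simp add: bij_betw_def)
  then have "card (A i \<inter> B j \<inter> K) = card (Pi\<^sub>E T V)"
    unfolding eq by (rule bij_betw_same_card)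
  also have "\<dots> = (\<Prod>t\<in>T. if I t < i \<or> J t < j then 1 else CARD('b))"
    using finT by (simp add: card_PiE V_def if_distrib cong: if_cong)
  also have "\<dots> = CARD('b) ^ card (T \<inter> - {t. I t < i \<or> J t < j})"
    using finT by (simp add: prod.If_cases)
  also have "T \<inter> - {t. I t < i \<or> J t < j} = {t \<in> T. i \<le> I t \<and> j \<le> J t}" by auto
  finally show ?thesis by (simp add: corner_count_def)
qed

text \<open>\<open>K'\<close> is the kernel of the sum of the coordinates in \<open>S\<close>, which
  are replaced by their partial sums: read from the front these cut out \<open>A\<close>, read from
  the back \<open>B\<close>. The full sum, sitting at \<open>m\<close>, is zero on \<open>K'\<close>
  and is dropped.\<close>

lemma frame_staircase_step:
  fixes \<tau> :: "'g::ab_group_add \<Rightarrow> 'l \<Rightarrow> 'b::{finite,ab_group_add}"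
  assumes F: "frame K A B T I J \<tau>" and S: "S \<subseteq> T" "S \<noteq> {}" and inj: "inj_on I S"
    and anti: "\<And>s u. s \<in> S \<Longrightarrow> u \<in> S \<Longrightarrow> I s < I u \<Longrightarrow> J u < J s"
  shows "\<exists>K' T' J' (\<tau>' :: 'g \<Rightarrow> 'l \<Rightarrow> 'b). K' \<subseteq> K \<and> frame K' A B T' I J' \<tau>' \<and>
    (\<forall>i j. corner_count T' I J' i j + of_bool (\<exists>s\<in>S. i \<le> I s \<and> j \<le> J s) = corner_count T I J i j)"
proof -
  have finT: "finite T" and finK: "finite K" and K: "additive_subgroup K" and cardK: "card K = CARD('b) ^ card T"
    and lin: "\<And>x y t. x \<in> K \<Longrightarrow> y \<in> K \<Longrightarrow> \<tau> (x - y) t = \<tau> x t - \<tau> y t"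
    and ker: "\<And>x. x \<in> K \<Longrightarrow> \<forall>t\<in>T. \<tau> x t = 0 \<Longrightarrow> x = 0"
    and A: "\<And>i x. x \<in> K \<Longrightarrow> x \<in> A i \<longleftrightarrow> (\<forall>t\<in>T. I t < i \<longrightarrow> \<tau> x t = 0)"
    and B: "\<And>j x. x \<in> K \<Longrightarrow> x \<in> B j \<longleftrightarrow> (\<forall>t\<in>T. J t < j \<longrightarrow> \<tau> x t = 0)"
    using F by (simp_all add: frame_def)
  have finS: "finite S" using S finT finite_subset by blast
  have "Max (I ` S) \<in> I ` S" using finS S by (intro Max_in) auto
  then obtain m where m: "m \<in> S" "I m = Max (I ` S)" by auto
  have mmax: "I u \<le> I m" if "u \<in> S" for u unfolding m(2) using that finS by simp
  define v where "v x = (\<Sum>s\<in>S. \<tau> x s)" for x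
  define K' where "K' = {x \<in> K. v x = 0}"
  define T' where "T' = T - {m}"
  define J' where "J' t = (if t \<in> S then Max (J ` {u \<in> S. I t < I u}) else J t)" for t
  define \<tau>' where "\<tau>' x t = (if t \<in> S then (\<Sum>u | u \<in> S \<and> I u \<le> I t. \<tau> x u) else \<tau> x t)" for x t
  have K'K: "K' \<subseteq> K" by (auto simp: K'_def)
  have vlin: "v (x - y) = v x - v y" if "x \<in> K" "y \<in> K" for x y
    using that by (simp add: v_def lin sum_subtractf)
  have K': "additive_subgroup K'"
  proof -
    have "v 0 = 0" using vlin[of 0 0] K by (simp add: additive_subgroup_def)
    then show ?thesis using K vlin by (auto simp: additive_subgroup_def K'_def)
  qed
  have lin': "\<tau>' (x - y) t = \<tau>' x t - \<tau>' y t" if "x \<in> K'" "y \<in> K'" for x y t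
  proof -
    have "x \<in> K" "y \<in> K" using that K'K by auto
    then show ?thesis by (simp add: \<tau>'_def lin sum_subtractf)
  qed
  have T'_eq: "T' = (S - {m}) \<union> (T - S)" using S(1) m(1) by (auto simp: T'_def)
  have A': "x \<in> A i \<longleftrightarrow> (\<forall>t\<in>T'. I t < i \<longrightarrow> \<tau>' x t = 0)" if x: "x \<in> K'" for x i
  proof -
    have xK: "x \<in> K" using x K'K by blast
    have S_iff: "(\<forall>u\<in>S. I u < i \<longrightarrow> \<tau> x u = 0) \<longleftrightarrow>
        (\<forall>t\<in>S - {m}. I t < i \<longrightarrow> (\<Sum>u | u \<in> S \<and> I u \<le> I t. \<tau> x u) = 0)"
      using x by (intro partial_sums_vanish_below_iff finS inj m(1) mmax) (auto simp: K'_def v_def)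
    have T_iff: "(\<forall>t\<in>T. I t < i \<longrightarrow> \<tau> x t = 0) \<longleftrightarrow>
        (\<forall>t\<in>S. I t < i \<longrightarrow> \<tau> x t = 0) \<and> (\<forall>t\<in>T - S. I t < i \<longrightarrow> \<tau> x t = 0)"
      using S(1) by blast
    have T'_iff: "(\<forall>t\<in>T'. I t < i \<longrightarrow> \<tau>' x t = 0) \<longleftrightarrow>
        (\<forall>t\<in>S - {m}. I t < i \<longrightarrow> (\<Sum>u | u \<in> S \<and> I u \<le> I t. \<tau> x u) = 0) \<and>
        (\<forall>t\<in>T - S. I t < i \<longrightarrow> \<tau> x t = 0)"
      unfolding T'_eq ball_Un by (simp add: \<tau>'_def J'_def)
    show ?thesis by (simp only: A[OF xK] T_iff T'_iff S_iff)
  qed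
  have B': "x \<in> B j \<longleftrightarrow> (\<forall>t\<in>T'. J' t < j \<longrightarrow> \<tau>' x t = 0)" if x: "x \<in> K'" for x j
  proof -
    have xK: "x \<in> K" using x K'K by blast
    have S_iff: "(\<forall>u\<in>S. J u < j \<longrightarrow> \<tau> x u = 0) \<longleftrightarrow>
        (\<forall>t\<in>S - {m}. Max (J ` {u \<in> S. I t < I u}) < j \<longrightarrow> (\<Sum>u | u \<in> S \<and> I u \<le> I t. \<tau> x u) = 0)"
      using x by (intro partial_sums_vanish_above_iff finS inj m(1) mmax anti) (auto simp: K'_def v_def)
    have T_iff: "(\<forall>t\<in>T. J t < j \<longrightarrow> \<tau> x t = 0) \<longleftrightarrow>
        (\<forall>t\<in>S. J t < j \<longrightarrow> \<tau> x t = 0) \<and> (\<forall>t\<in>T - S. J t < j \<longrightarrow> \<tau> x t = 0)"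
      using S(1) by blast
    have T'_iff: "(\<forall>t\<in>T'. J' t < j \<longrightarrow> \<tau>' x t = 0) \<longleftrightarrow>
        (\<forall>t\<in>S - {m}. Max (J ` {u \<in> S. I t < I u}) < j \<longrightarrow> (\<Sum>u | u \<in> S \<and> I u \<le> I t. \<tau> x u) = 0) \<and>
        (\<forall>t\<in>T - S. J t < j \<longrightarrow> \<tau> x t = 0)"
      unfolding T'_eq ball_Un by (simp add: \<tau>'_def J'_def)
    show ?thesis by (simp only: B[OF xK] T_iff T'_iff S_iff)
  qed
  have ker': "x = 0" if x: "x \<in> K'" "\<forall>t\<in>T'. \<tau>' x t = 0" for x
  proof -
    \<comment> \<open>Beyond the last level all coordinates in \<open>T\<close> are required to
      vanish.\<close>
    have "x \<in> A (Suc (Max (I ` T)))" using A'[OF x(1)] x(2) by blast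
    moreover have "I t < Suc (Max (I ` T))" if "t \<in> T" for t
      using that finT by (simp add: le_imp_less_Suc)
    ultimately show ?thesis using A[of x] K'K x(1) by (intro ker) auto
  qed
  have cardK': "card K' = CARD('b) ^ card T'"
  proof -
    \<comment> \<open>Every fibre of \<open>v\<close> is a translate of \<open>K'\<close>: some
      \<open>w\<close> in \<open>K\<close> has coordinate \<open>b\<close> at \<open>m\<close> and
      zero elsewhere on \<open>T\<close>. Hence \<open>K'\<close> has index
      \<open>CARD('b)\<close>.\<close>
    have fibre: "card {x \<in> K. v x = b} = card K'" for b
    proof -
      have "(\<lambda>t\<in>T. if t = m then b else 0) \<in> (\<lambda>x. restrict (\<tau> x) T) ` K"
        using frame_bij[OF F] by (auto simp: bij_betw_def)
      then obtain w where w: "w \<in> K" "restrict (\<tau> w) T = (\<lambda>t\<in>T. if t = m then b else 0)" by auto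
      have "\<tau> w s = (if s = m then b else 0)" if "s \<in> S" for s
        using fun_cong[OF w(2), of s] that S by auto
      then have vw: "v w = b" using m(1) finS by (simp add: v_def)
      have "(\<lambda>x. x - w) ` {x \<in> K. v x = b} = K'"
      proof (intro set_eqI iffI)
        fix y assume "y \<in> (\<lambda>x. x - w) ` {x \<in> K. v x = b}"
        then show "y \<in> K'" using w K vlin vw by (auto simp: K'_def additive_subgroup_def)
      next
        fix y assume y: "y \<in> K'"
        have yw: "y + w \<in> K" using y w K K'K by (auto intro: additive_subgroup_add)
        have "v y = v (y + w) - v w" using vlin[OF yw w(1)] by simp
        then have "v (y + w) = b" using vw y by (simp add: K'_def)
        then show "y \<in> (\<lambda>x. x - w) ` {x \<in> K. v x = b}"
          using yw by (intro image_eqI[of _ _ "y + w"]) auto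
      qed
      moreover have "inj_on (\<lambda>x. x - w) {x \<in> K. v x = b}" by (auto intro: inj_onI)
      ultimately show ?thesis by (metis card_image)
    qed
    have "card K = (\<Sum>b\<in>UNIV. card {x \<in> K. v x = b})"
      using sum.group[of K UNIV v "\<lambda>_. 1::nat"] finK by simp
    then have "card K = CARD('b) * card K'" by (simp add: fibre)
    moreover have "card T = Suc (card T')" unfolding T'_def using m(1) S finT by (metis card.remove in_mono)
    ultimately show ?thesis using cardK by simp
  qed
  have "frame K' A B T' I J' \<tau>'"
    unfolding frame_def
  proof (intro conjI ballI allI impI)
    show "finite T'" "finite K'" using finT finK K'K finite_subset by (auto simp: T'_def)
  qed (use K' cardK' lin' ker' A' B' in \<open>simp_all only:\<close>)
  moreover have "corner_count T' I J' i j + of_bool (\<exists>s\<in>S. i \<le> I s \<and> j \<le> J s) = corner_count T I J i j" for i j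
  proof -
    let ?R = "{t \<in> T - S. i \<le> I t \<and> j \<le> J t}"
    have "corner_count T I J i j = card ({t \<in> S. i \<le> I t \<and> j \<le> J t} \<union> ?R)"
      unfolding corner_count_def using S by (intro arg_cong[of _ _ card]) auto
    then have c: "corner_count T I J i j = card {t \<in> S. i \<le> I t \<and> j \<le> J t} + card ?R"
      using finT finS by (subst (asm) card_Un_disjoint) auto
    have "corner_count T' I J' i j = card ({t \<in> S - {m}. i \<le> I t \<and> j \<le> Max (J ` {u \<in> S. I t < I u})} \<union> ?R)"
      unfolding corner_count_def using S(1) m(1) by (intro arg_cong[of _ _ card]) (auto simp: T'_def J'_def)
    then have c': "corner_count T' I J' i j =
        card {t \<in> S - {m}. i \<le> I t \<and> j \<le> Max (J ` {u \<in> S. I t < I u})} + card ?R"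
      using finT finS by (subst (asm) card_Un_disjoint) auto
    show ?thesis
      using card_staircase_step[where I = I and J = J and i = i and j = j, OF finS inj m(1) mmax anti] unfolding c c' by simp
  qed
  ultimately show ?thesis using K'K by blast
qed

section \<open>Three flags with prescribed ranks\<close>

text \<open>The maximal points of a finite down-set are its outer corners. They descend strictly and
  generate the set, and \<open>corner\<close> supplies a coordinate for each of them.\<close>

lemma staircase_of_down_set:
  fixes I J :: "'l \<Rightarrow> nat"
  assumes down: "\<And>i j i' j'. D i' j' \<Longrightarrow> i \<le> i' \<Longrightarrow> j \<le> j' \<Longrightarrow> D i j"
    and fin: "finite {(i, j). D i j}" and ne: "D 0 0"
    and corner: "\<And>i j. D i j \<Longrightarrow> \<not> D (Suc i) j \<Longrightarrow> \<not> D i (Suc j) \<Longrightarrow> \<exists>t\<in>T. I t = i \<and> J t = j"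
  shows "\<exists>S. S \<subseteq> T \<and> S \<noteq> {} \<and> inj_on I S \<and> (\<forall>s\<in>S. \<forall>u\<in>S. I s < I u \<longrightarrow> J u < J s) \<and>
    (\<forall>i j. D i j \<longleftrightarrow> (\<exists>s\<in>S. i \<le> I s \<and> j \<le> J s))"
proof -
  define E where "E = {(i, j). D i j \<and> \<not> D (Suc i) j \<and> \<not> D i (Suc j)}"
  have "\<forall>p\<in>E. \<exists>t\<in>T. I t = fst p \<and> J t = snd p"
    using corner by (auto simp: E_def)
  then obtain c where c: "\<And>p. p \<in> E \<Longrightarrow> c p \<in> T" "\<And>p. p \<in> E \<Longrightarrow> I (c p) = fst p" "\<And>p. p \<in> E \<Longrightarrow> J (c p) = snd p"
    by metis
  have lt: "j' < j" if "(i, j) \<in> E" "(i', j') \<in> E" "i < i'" for i j i' j'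
  proof (rule ccontr)
    assume "\<not> j' < j"
    then have "D (Suc i) j" using that down[of i' j' "Suc i" j] by (auto simp: E_def)
    then show False using that by (simp add: E_def)
  qed
  have le: "j \<le> j'" if "(i, j) \<in> E" "(i, j') \<in> E" for i j j'
  proof (rule ccontr)
    assume "\<not> j \<le> j'"
    then have "D i (Suc j')" using that down[of i j i "Suc j'"] by (auto simp: E_def)
    then show False using that by (simp add: E_def)
  qed
  have above: "\<exists>(i', j')\<in>E. i \<le> i' \<and> j \<le> j'" if "D i j" for i j
  proof -
    \<comment> \<open>Among the points of the set above \<open>(i, j)\<close>, one with the largest
      coordinate sum is an outer corner.\<close>
    let ?X = "{(a, b). D a b \<and> i \<le> a \<and> j \<le> b}"
    have finX: "finite ?X" using fin by (rule rev_finite_subset) auto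
    have "Max ((\<lambda>(a, b). a + b) ` ?X) \<in> (\<lambda>(a, b). a + b) ` ?X"
      using finX that by (intro Max_in) auto
    then obtain a b where ab: "D a b" "i \<le> a" "j \<le> b" "a + b = Max ((\<lambda>(a, b). a + b) ` ?X)"
      by auto
    have ge: "a' + b' \<le> a + b" if "D a' b'" "i \<le> a'" "j \<le> b'" for a' b'
      unfolding ab(4) using finX that by (intro Max_ge) (auto intro!: image_eqI[of _ _ "(a', b')"])
    have "(a, b) \<in> E" using ge[of "Suc a" b] ge[of a "Suc b"] ab by (auto simp: E_def)
    then show ?thesis using ab by blast
  qed
  show ?thesis
  proof (intro exI[of _ "c ` E"] conjI)
    show "c ` E \<subseteq> T" using c by auto
    show "c ` E \<noteq> {}" using above[OF ne] by auto
    show "inj_on I (c ` E)"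
    proof (rule inj_onI)
      fix x y assume "x \<in> c ` E" "y \<in> c ` E" "I x = I y"
      then obtain p q where pq: "p \<in> E" "q \<in> E" "x = c p" "y = c q" "fst p = fst q" using c(2) by auto
      then have "snd p = snd q"
        using le[of "fst p" "snd p" "snd q"] le[of "fst p" "snd q" "snd p"] by (cases p; cases q) auto
      then have "p = q" using pq(5) by (simp add: prod_eq_iff)
      then show "x = y" using pq(3,4) by simp
    qed
    show "\<forall>s\<in>c ` E. \<forall>u\<in>c ` E. I s < I u \<longrightarrow> J u < J s"
      using c(2,3) lt by auto
    show "\<forall>i j. D i j \<longleftrightarrow> (\<exists>s\<in>c ` E. i \<le> I s \<and> j \<le> J s)"
    proof (intro allI iffI)
      fix i j assume "D i j"
      then obtain a b where "(a, b) \<in> E" "i \<le> a" "j \<le> b" using above by blast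
      then show "\<exists>s\<in>c ` E. i \<le> I s \<and> j \<le> J s"
        using c(2,3)[of "(a, b)"] by (intro bexI[of _ "c (a, b)"]) auto
    next
      fix i j assume "\<exists>s\<in>c ` E. i \<le> I s \<and> j \<le> J s"
      then obtain p where "p \<in> E" "i \<le> fst p" "j \<le> snd p" using c(2,3) by auto
      then show "D i j" using down[of "fst p" "snd p" i j] by (auto simp: E_def)
    qed
  qed
qed

text \<open>One step of the third flag. The layers of the difference \<open>\<delta>\<close> of the two counts are removed one at
  a time, beginning with the largest layer \<open>{\<delta> \<ge> 1}\<close>: at its outer corners supermodularity of \<open>R\<close>
  provides the coordinates that the step needs.\<close>
lemma frame_lower_counts:
  fixes \<tau> :: "'g::ab_group_add \<Rightarrow> 'l \<Rightarrow> 'b::{finite,ab_group_add}"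
  assumes "frame K A B T I J \<tau>"
    and super: "\<And>i j. R (Suc i) j + R i (Suc j) \<le> R i j + R (Suc i) (Suc j)"
    and "\<And>i j. R i j \<le> corner_count T I J i j"
    and "\<And>i j. corner_count T I J (Suc i) j + R i j \<le> corner_count T I J i j + R (Suc i) j"
    and "\<And>i j. corner_count T I J i (Suc j) + R i j \<le> corner_count T I J i j + R i (Suc j)"
  shows "\<exists>K' T' J' (\<tau>' :: 'g \<Rightarrow> 'l \<Rightarrow> 'b). K' \<subseteq> K \<and> frame K' A B T' I J' \<tau>' \<and> corner_count T' I J' = R"
  using assms(1,3-5)
\<comment> \<open>The induction runs on the value of the difference \<delta> at the origin, where it
  is largest.\<close>
proof (induction "corner_count T I J 0 0 - R 0 0" arbitrary: K T J \<tau>)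
  case 0
  define \<delta> where "\<delta> i j = corner_count T I J i j - R i j" for i j
  have step: "\<delta> (Suc i) j \<le> \<delta> i j" "\<delta> i (Suc j) \<le> \<delta> i j" for i j
    using 0(4)[of i j] 0(5)[of i j] 0(3)[of i j] 0(3)[of "Suc i" j] 0(3)[of i "Suc j"] by (auto simp: \<delta>_def)
  have "corner_count T I J i j = R i j" for i j
  proof -
    have "\<delta> i j \<le> \<delta> 0 j" by (rule lift_Suc_antimono_le[of "\<lambda>i. \<delta> i j", OF step(1)]) simp
    also have "\<dots> \<le> \<delta> 0 0" by (rule lift_Suc_antimono_le[of "\<lambda>j. \<delta> 0 j", OF step(2)]) simp
    finally show ?thesis using 0(1) 0(3)[of i j] by (simp add: \<delta>_def)
  qed
  then have "corner_count T I J = R" by (intro ext)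
  then show ?case using 0(2) by blast
next
  case (Suc n)
  let ?c = "corner_count T I J"
  define \<delta> where "\<delta> i j = ?c i j - R i j" for i j
  have finT: "finite T" using Suc(3) by (simp add: frame_def)
  have c: "?c i j = R i j + \<delta> i j" for i j using Suc(4)[of i j] by (simp add: \<delta>_def)
  have \<delta>_step: "\<delta> (Suc i) j \<le> \<delta> i j" "\<delta> i (Suc j) \<le> \<delta> i j" for i j
    using Suc(5)[of i j] Suc(6)[of i j] unfolding c by auto
  have \<delta>_anti: "\<delta> i' j' \<le> \<delta> i j" if "i \<le> i'" "j \<le> j'" for i j i' j'
  proof -
    have "\<delta> i' j' \<le> \<delta> i j'" using that(1) by (rule lift_Suc_antimono_le[of "\<lambda>i. \<delta> i j'", OF \<delta>_step(1)])
    also have "\<dots> \<le> \<delta> i j" using that(2) by (rule lift_Suc_antimono_le[of "\<lambda>j. \<delta> i j", OF \<delta>_step(2)])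
    finally show ?thesis .
  qed
  define D where "D i j \<longleftrightarrow> 0 < \<delta> i j" for i j
  have "\<exists>S. S \<subseteq> T \<and> S \<noteq> {} \<and> inj_on I S \<and> (\<forall>s\<in>S. \<forall>u\<in>S. I s < I u \<longrightarrow> J u < J s) \<and>
    (\<forall>i j. D i j \<longleftrightarrow> (\<exists>s\<in>S. i \<le> I s \<and> j \<le> J s))"
  proof (rule staircase_of_down_set[where D = D and T = T and I = I and J = J])
    show "D i j" if "D i' j'" "i \<le> i'" "j \<le> j'" for i j i' j'
      using \<delta>_anti[OF that(2,3)] that(1) by (simp add: D_def)
    show "D 0 0" using Suc(2) by (simp add: D_def \<delta>_def)
    have "\<exists>t\<in>T. i \<le> I t \<and> j \<le> J t" if "D i j" for i j
    proof -
      have "?c i j \<noteq> 0" using that c[of i j] by (simp add: D_def)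
      then show ?thesis by (auto simp: corner_count_def card_eq_0_iff)
    qed
    then have "{(i, j). D i j} \<subseteq> (\<Union>t\<in>T. {..I t} \<times> {..J t})" by auto
    then show "finite {(i, j). D i j}" using finT by (auto intro: finite_subset)
    \<comment> \<open>At an outer corner \<delta> is positive and vanishes at the three neighbours,
      so the second difference of the count exceeds that of \<open>R\<close>, which is
      nonnegative.\<close>
    show "\<exists>t\<in>T. I t = i \<and> J t = j" if "D i j" "\<not> D (Suc i) j" "\<not> D i (Suc j)" for i j
    proof -
      have "\<delta> (Suc i) (Suc j) = 0" using that(2) \<delta>_step(2)[of "Suc i" j] by (simp add: D_def)
      then have "card {t \<in> T. I t = i \<and> J t = j} \<noteq> 0"
        using corner_count_rec[OF finT, of I J i j] super[of i j] that unfolding c D_def by simp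
      then show ?thesis by (auto simp: card_eq_0_iff)
    qed
  qed
  then obtain S where S: "S \<subseteq> T" "S \<noteq> {}" "inj_on I S" and anti: "\<forall>s\<in>S. \<forall>u\<in>S. I s < I u \<longrightarrow> J u < J s"
    and "\<forall>i j. D i j \<longleftrightarrow> (\<exists>s\<in>S. i \<le> I s \<and> j \<le> J s)" by (elim exE conjE)
  then have DS: "\<And>i j. D i j \<longleftrightarrow> (\<exists>s\<in>S. i \<le> I s \<and> j \<le> J s)" by simp
  have "\<exists>K' T' J' (\<tau>' :: 'g \<Rightarrow> 'l \<Rightarrow> 'b). K' \<subseteq> K \<and> frame K' A B T' I J' \<tau>' \<and>
      (\<forall>i j. corner_count T' I J' i j + of_bool (\<exists>s\<in>S. i \<le> I s \<and> j \<le> J s) = ?c i j)"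
    by (rule frame_staircase_step[OF Suc(3) S]) (simp add: anti)
  then obtain K1 T1 J1 and \<tau>1 :: "'g \<Rightarrow> 'l \<Rightarrow> 'b" where K1: "K1 \<subseteq> K" "frame K1 A B T1 I J1 \<tau>1"
    and c1_eq: "\<forall>i j. corner_count T1 I J1 i j + of_bool (\<exists>s\<in>S. i \<le> I s \<and> j \<le> J s) = ?c i j"
    by (elim exE conjE)
  \<comment> \<open>Truncated subtraction keeps the difference at 0 outside \<open>D\<close>; what
    remains is still decreasing in both arguments.\<close>
  have c1: "corner_count T1 I J1 i j = R i j + (\<delta> i j - 1)" for i j
    using c1_eq[rule_format, of i j] c[of i j] by (cases "D i j") (auto simp: DS[symmetric] D_def)
  have "\<exists>K' T' J' (\<tau>' :: 'g \<Rightarrow> 'l \<Rightarrow> 'b). K' \<subseteq> K1 \<and> frame K' A B T' I J' \<tau>' \<and> corner_count T' I J' = R"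
  proof (rule Suc(1)[where K = K1 and T = T1 and J = J1 and \<tau> = \<tau>1, OF _ K1(2)])
    show "n = corner_count T1 I J1 0 0 - R 0 0" using Suc(2) c[of 0 0] by (simp add: c1)
    show "corner_count T1 I J1 (Suc i) j + R i j \<le> corner_count T1 I J1 i j + R (Suc i) j" for i j
      using \<delta>_step(1)[of i j] by (simp add: c1)
    show "corner_count T1 I J1 i (Suc j) + R i j \<le> corner_count T1 I J1 i j + R i (Suc j)" for i j
      using \<delta>_step(2)[of i j] by (simp add: c1)
  qed (simp add: c1)
  then obtain K' T' J' and \<tau>' :: "'g \<Rightarrow> 'l \<Rightarrow> 'b" where "K' \<subseteq> K1" "frame K' A B T' I J' \<tau>'" "corner_count T' I J' = R"
    by (elim exE conjE)
  then show ?case using K1(1) by (intro exI[of _ K'] exI[of _ T'] exI[of _ J'] exI[of _ \<tau>']) auto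
qed

text \<open>Each position receives as many coordinates as the mixed second difference of
  \<open>R\<close>, nonnegative by \<open>super\<close>; summing inward from the border
  \<open>M\<close>, where \<open>R\<close> vanishes, recovers \<open>R\<close>.\<close>

lemma exists_corner_count:
  fixes R :: "nat \<Rightarrow> nat \<Rightarrow> nat"
  assumes zero: "\<And>i j. M \<le> i \<or> M \<le> j \<Longrightarrow> R i j = 0"
    and super: "\<And>i j. R (Suc i) j + R i (Suc j) \<le> R i j + R (Suc i) (Suc j)"
  shows "\<exists>(T :: (nat \<times> nat \<times> nat) set) I J. finite T \<and> corner_count T I J = R"
proof -
  define a where "a i j = R i j + R (Suc i) (Suc j) - R (Suc i) j - R i (Suc j)" for i j
  define T where "T = (SIGMA i:{..<M}. SIGMA j:{..<M}. {..<a i j})"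
  define I J where "I = (\<lambda>t :: nat \<times> nat \<times> nat. fst t)" and "J = (\<lambda>t :: nat \<times> nat \<times> nat. fst (snd t))"
  have finT: "finite T" by (auto simp: T_def)
  have "corner_count T I J i j = R i j" for i j
  proof (induction "(M - i) + (M - j)" arbitrary: i j rule: less_induct)
    case less
    show ?case
    proof (cases "M \<le> i \<or> M \<le> j")
      case True
      then have none: "{t \<in> T. i \<le> I t \<and> j \<le> J t} = {}" by (auto simp: T_def I_def J_def)
      have "corner_count T I J i j = 0" unfolding corner_count_def none by simp
      then show ?thesis using zero True by simp
    next
      case False
      have "{t \<in> T. I t = i \<and> J t = j} = (\<lambda>l. (i, j, l)) ` {..<a i j}"
        using False by (auto simp: T_def I_def J_def)
      then have "card {t \<in> T. I t = i \<and> J t = j} = a i j"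
        by (simp add: card_image inj_on_def)
      moreover have "corner_count T I J (Suc i) j = R (Suc i) j" by (rule less) (use False in auto)
      moreover have "corner_count T I J i (Suc j) = R i (Suc j)" by (rule less) (use False in auto)
      moreover have "corner_count T I J (Suc i) (Suc j) = R (Suc i) (Suc j)" by (rule less) (use False in auto)
      ultimately show ?thesis
        using corner_count_rec[OF finT, of I J i j] super[of i j] by (simp add: a_def)
    qed
  qed
  then have "corner_count T I J = R" by (intro ext)
  then show ?thesis using finT by blast
qed

text \<open>The index \<open>k\<close> belongs to the third flag. Up to sign, \<open>super\<close>
  and \<open>anti\<close> express submodularity in the three pairs of directions.\<close>

theorem three_flags_realization:
  fixes R :: "nat \<Rightarrow> nat \<Rightarrow> nat \<Rightarrow> nat"
  assumes zero: "\<And>k i j. M \<le> i \<or> M \<le> j \<Longrightarrow> R k i j = 0"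
    and super: "\<And>k i j. R k (Suc i) j + R k i (Suc j) \<le> R k i j + R k (Suc i) (Suc j)"
    and dec: "\<And>k i j. R (Suc k) i j \<le> R k i j"
    and anti: "\<And>k i j. R k (Suc i) j + R (Suc k) i j \<le> R k i j + R (Suc k) (Suc i) j"
      "\<And>k i j. R k i (Suc j) + R (Suc k) i j \<le> R k i j + R (Suc k) i (Suc j)"
  shows "\<exists>A B C :: nat \<Rightarrow> (nat \<times> nat \<times> nat \<Rightarrow> 2) set. antimono A \<and> antimono B \<and> antimono C \<and>
    (\<forall>i. additive_subgroup (A i) \<and> additive_subgroup (B i) \<and> additive_subgroup (C i) \<and> finite (A i)) \<and>
    (\<forall>i j k. card (A i \<inter> B j \<inter> C k) = 2 ^ R k i j)"
proof -
  obtain T :: "(nat \<times> nat \<times> nat) set" and I J where T: "finite T" "corner_count T I J = R 0"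
    using exists_corner_count[of M "R 0", OF zero super] by blast
  \<comment> \<open>The full coordinate space, extended by zero outside \<open>T\<close>; with the
    levels \<open>I\<close> and \<open>J\<close> it realises \<open>R 0\<close>.\<close>
  define \<Omega> :: "(nat \<times> nat \<times> nat \<Rightarrow> 2) set" where "\<Omega> = PiE_dflt T 0 (\<lambda>_. UNIV)"
  have \<Omega>: "\<omega> \<in> \<Omega> \<longleftrightarrow> (\<forall>t. t \<notin> T \<longrightarrow> \<omega> t = 0)" for \<omega> by (auto simp: \<Omega>_def PiE_dflt_def)
  have fin\<Omega>: "finite \<Omega>" unfolding \<Omega>_def using T(1) by (intro finite_PiE_dflt) auto
  have card\<Omega>: "card \<Omega> = 2 ^ card T" unfolding \<Omega>_def using T(1) by (subst card_PiE_dflt) auto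
  define A where "A i = {\<omega> \<in> \<Omega>. \<forall>t\<in>T. I t < i \<longrightarrow> \<omega> t = 0}" for i
  define B where "B j = {\<omega> \<in> \<Omega>. \<forall>t\<in>T. J t < j \<longrightarrow> \<omega> t = 0}" for j
  have sub: "additive_subgroup \<Omega>" "additive_subgroup (A i)" "additive_subgroup (B i)" for i
    by (auto simp: additive_subgroup_def A_def B_def \<Omega>)
  have F: "frame \<Omega> A B T I J (\<lambda>\<omega>. \<omega>)"
    unfolding frame_def
  proof (intro conjI ballI allI impI)
    fix \<omega> assume "\<omega> \<in> \<Omega>" "\<forall>t\<in>T. \<omega> t = 0"
    then have "\<omega> t = 0" for t using \<Omega>[of \<omega>] by blast
    then show "\<omega> = 0" by (intro ext) simp
  qed (use T(1) fin\<Omega> card\<Omega> sub in \<open>simp_all add: A_def B_def\<close>)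
  \<comment> \<open>Dependent choice builds \<open>C\<close> while \<open>A\<close>,
    \<open>B\<close> and \<open>I\<close> stay fixed; the coordinates and the levels
    \<open>J\<close> are chosen anew at each step.\<close>
  have "\<exists>C. \<forall>k. (\<exists>(T :: (nat \<times> nat \<times> nat) set) J \<tau>. frame (C k) A B T I J (\<tau> :: _ \<Rightarrow> _ \<Rightarrow> 2) \<and> corner_count T I J = R k)
      \<and> C (Suc k) \<subseteq> C k"
  proof (rule dependent_nat_choice)
    show "\<exists>K. \<exists>(T :: (nat \<times> nat \<times> nat) set) J \<tau>. frame K A B T I J (\<tau> :: _ \<Rightarrow> _ \<Rightarrow> 2) \<and> corner_count T I J = R 0"
      using F T(2) by blast
  next
    fix K k assume "\<exists>(T :: (nat \<times> nat \<times> nat) set) J \<tau>. frame K A B T I J (\<tau> :: _ \<Rightarrow> _ \<Rightarrow> 2) \<and> corner_count T I J = R k"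
    then obtain T :: "(nat \<times> nat \<times> nat) set" and J \<tau> where *: "frame K A B T I J (\<tau> :: _ \<Rightarrow> _ \<Rightarrow> 2)" "corner_count T I J = R k"
      by blast
    have "\<exists>K' T' J' (\<tau>' :: _ \<Rightarrow> _ \<Rightarrow> 2). K' \<subseteq> K \<and> frame K' A B T' I J' \<tau>' \<and> corner_count T' I J' = R (Suc k)"
      by (rule frame_lower_counts[where R = "R (Suc k)", OF *(1)]) (simp_all only: *(2) super dec anti)
    then show "\<exists>K'. (\<exists>(T :: (nat \<times> nat \<times> nat) set) J \<tau>. frame K' A B T I J (\<tau> :: _ \<Rightarrow> _ \<Rightarrow> 2) \<and> corner_count T I J = R (Suc k)) \<and> K' \<subseteq> K"
      by blast
  qed
  then obtain C where C: "\<forall>k. (\<exists>(T :: (nat \<times> nat \<times> nat) set) J \<tau>. frame (C k) A B T I J (\<tau> :: _ \<Rightarrow> _ \<Rightarrow> 2) \<and> corner_count T I J = R k)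
      \<and> C (Suc k) \<subseteq> C k"
    by (elim exE)
  have "card (A i \<inter> B j \<inter> C k) = 2 ^ R k i j" and C_sub: "additive_subgroup (C k)" for i j k
  proof -
    obtain T :: "(nat \<times> nat \<times> nat) set" and J \<tau> where *: "frame (C k) A B T I J (\<tau> :: _ \<Rightarrow> _ \<Rightarrow> 2)" "corner_count T I J = R k"
      using C[rule_format, of k, THEN conjunct1] by (elim exE conjE)
    show "card (A i \<inter> B j \<inter> C k) = 2 ^ R k i j" using frame_card_Int[OF *(1), of i j] by (simp add: *(2))
    show "additive_subgroup (C k)" using *(1) by (simp add: frame_def)
  qed
  moreover have "antimono C" using C by (intro decseq_SucI) simp
  moreover have "antimono A" "antimono B" by (auto simp: A_def B_def antimono_def)
  moreover have "finite (A i)" for i using fin\<Omega> by (rule rev_finite_subset) (auto simp: A_def)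
  ultimately show ?thesis using sub by (intro exI[of _ A] exI[of _ B] exI[of _ C]) simp
qed

section \<open>Entropic functions from subgroups\<close>

text \<open>With probability \<open>1 - p\<close> every variable shows the same dummy value,
  otherwise \<open>Y x\<close> at a uniform point of \<open>S\<close>. This scales entropies by
  \<open>p\<close>, at the common cost of the binary entropy of \<open>p\<close>.\<close>

lemma entropic_of_uniform_fibres:
  fixes Y :: "'a::{finite,distrib_lattice} \<Rightarrow> 's \<Rightarrow> 'c" and c :: "'a \<Rightarrow> nat"
  assumes S: "finite S" "S \<noteq> {}" and p: "0 < p" "p < 1"
    and join: "\<And>x y s s'. s \<in> S \<Longrightarrow> s' \<in> S \<Longrightarrow>
      Y (sup x y) s = Y (sup x y) s' \<longleftrightarrow> Y x s = Y x s' \<and> Y y s = Y y s'"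
    and fibre: "\<And>x s. s \<in> S \<Longrightarrow> card {s' \<in> S. Y x s' = Y x s} = c x"
  shows "entropic (\<lambda>x. (- (1 - p) * log 2 (1 - p) - p * log 2 p) + p * (log 2 (card S) - log 2 (c x)))"
proof -
  \<comment> \<open>Values must lie in \<open>nat\<close>, so the finitely many values of
    \<open>Y\<close> are encoded; \<open>Suc\<close> below keeps them apart from the dummy value
    0.\<close>
  obtain e :: "'c \<Rightarrow> nat" where e: "inj_on e (\<Union>x. Y x ` S)"
    using finite_imp_inj_to_nat_seg[of "\<Union>x. Y x ` S"] S(1) by auto
  define V where "V x w = (case w of None \<Rightarrow> 0 | Some s \<Rightarrow> Suc (e (Y x s)))" for x and w :: "'s option"
  define \<nu> where "\<nu> = bind_pmf (bernoulli_pmf p) (\<lambda>b. if b then map_pmf Some (pmf_of_set S) else return_pmf None)"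
  define \<mu> where "\<mu> = map_pmf (\<lambda>w x. V x w) \<nu>"
  have prob: "measure_pmf.prob \<nu> W = (1 - p) * indicator W None + p * (card {s \<in> S. Some s \<in> W} / card S)" for W
  proof -
    have "measure_pmf.prob \<nu> W = p * measure_pmf.prob (map_pmf Some (pmf_of_set S)) W
        + (1 - p) * measure_pmf.prob (return_pmf None) W"
    proof -
      have "ennreal (measure_pmf.prob \<nu> W) = ennreal (measure_pmf.prob (map_pmf Some (pmf_of_set S)) W) * ennreal p
          + ennreal (measure_pmf.prob (return_pmf None) W) * ennreal (1 - p)"
        unfolding measure_pmf.emeasure_eq_measure[symmetric] \<nu>_def emeasure_bind_pmf
        using p by (subst nn_integral_bernoulli_pmf) auto
      also have "\<dots> = ennreal (measure_pmf.prob (map_pmf Some (pmf_of_set S)) W * p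
          + measure_pmf.prob (return_pmf None) W * (1 - p))"
        using p by (simp only: ennreal_mult'[symmetric] ennreal_plus[symmetric] measure_nonneg
            mult_nonneg_nonneg less_imp_le diff_ge_0_iff_ge)
      finally have "measure_pmf.prob \<nu> W = measure_pmf.prob (map_pmf Some (pmf_of_set S)) W * p
          + measure_pmf.prob (return_pmf None) W * (1 - p)"
        using p by (subst (asm) ennreal_inj) auto
      then show ?thesis by (simp only: mult.commute)
    qed
    moreover have "measure_pmf.prob (map_pmf Some (pmf_of_set S)) W = card {s \<in> S. Some s \<in> W} / card S"
      using S by (simp add: measure_map_pmf measure_pmf_of_set vimage_def Int_def)
    ultimately show ?thesis by (simp add: indicator_def)
  qed
  have cS: "0 < card S" using S by (simp add: card_gt_0_iff)
  have pmf_None: "pmf \<nu> None = 1 - p" using prob[of "{None}"] by (simp add: pmf.rep_eq)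
  have pmf_Some: "pmf \<nu> (Some s) = p / card S" if "s \<in> S" for s
  proof -
    have "{s' \<in> S. s' = s} = {s}" using that by auto
    then show ?thesis using prob[of "{Some s}"] by (simp add: pmf.rep_eq)
  qed
  have set: "set_pmf \<nu> = insert None (Some ` S)"
    using p by (simp add: \<nu>_def set_pmf_bernoulli UNIV_bool set_pmf_of_set[OF S(2,1)])
  have a_None: "atom_prob \<nu> (V x) None = 1 - p" for x
    unfolding atom_prob_def prob by (simp add: V_def)
  have Y_eq: "e (Y x s) = e (Y x s') \<longleftrightarrow> Y x s = Y x s'" if "s \<in> S" "s' \<in> S" for x s s'
    using e that by (intro inj_on_eq_iff) auto
  have a_Some: "atom_prob \<nu> (V x) (Some s) = p * (c x / card S)" if "s \<in> S" for x s
  proof -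
    have "{s' \<in> S. e (Y x s') = e (Y x s)} = {s' \<in> S. Y x s' = Y x s}" using Y_eq that by auto
    then show ?thesis unfolding atom_prob_def prob by (simp add: V_def fibre[OF that])
  qed
  have c_pos: "0 < c x" for x
  proof -
    obtain s where s: "s \<in> S" using S by blast
    have "0 < card {s' \<in> S. Y x s' = Y x s}" using s S(1) by (auto simp: card_gt_0_iff)
    then show ?thesis using fibre[OF s, of x] by simp
  qed
  have fin: "finite_ent \<nu> (V x)" for x
    unfolding finite_ent_def using set S by (intro integrable_measure_pmf_finite) simp
  have ent: "ent \<nu> (V x) = (- (1 - p) * log 2 (1 - p) - p * log 2 p) + p * (log 2 (card S) - log 2 (c x))" for x
  proof -
    have "ent \<nu> (V x) = (\<Sum>w\<in>insert None (Some ` S). pmf \<nu> w *\<^sub>R - log 2 (atom_prob \<nu> (V x) w))"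
      unfolding ent_def using set S by (intro integral_measure_pmf) auto
    also have "\<dots> = (1 - p) * - log 2 (1 - p) + (\<Sum>s\<in>S. p / card S * - log 2 (p * (c x / card S)))"
      using S by (simp add: sum.reindex pmf_None pmf_Some a_None a_Some)
    also have "\<dots> = (1 - p) * - log 2 (1 - p) + p * - log 2 (p * (c x / card S))"
      using cS by simp
    also have "log 2 (p * (c x / card S)) = log 2 p + log 2 (c x) - log 2 (card S)"
      using p cS c_pos[of x] by (simp add: log_mult log_divide)
    finally show ?thesis by (simp add: algebra_simps)
  qed
  have si: "same_info \<mu> (\<lambda>\<omega>. \<omega> (sup x y)) (\<lambda>\<omega>. (\<omega> x, \<omega> y))" for x y
  proof -
    have "V (sup x y) w = V (sup x y) w' \<longleftrightarrow> V x w = V x w' \<and> V y w = V y w'"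
      if "w \<in> set_pmf \<nu>" "w' \<in> set_pmf \<nu>" for w w'
      using that unfolding set by (auto simp: V_def Y_eq join)
    then show ?thesis by (simp add: same_info_def \<mu>_def)
  qed
  show ?thesis
    unfolding entropic_iff
    using si fin ent by (intro exI[of _ \<mu>]) (simp add: \<mu>_def finite_ent_map_pmf ent_map_pmf)
qed

text \<open>The variables are cosets of a uniform element of \<Omega>: a coset of an intersection
  amounts to a pair of cosets. A uniform element of \<open>{..<N}\<close> visible to all variables
  shifts every entropy, before scaling, by \<open>log 2 N\<close>.\<close>

lemma entropic_of_subgroups:
  fixes K :: "'a::{finite,distrib_lattice} \<Rightarrow> 'g::ab_group_add set"
  assumes \<Omega>: "finite \<Omega>" "additive_subgroup \<Omega>" and K: "\<And>x. additive_subgroup (K x)" "\<And>x. K x \<subseteq> \<Omega>"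
    and join: "\<And>x y. K (sup x y) = K x \<inter> K y" and N: "0 < N" and p: "0 < p" "p < 1"
  shows "entropic (\<lambda>x. (- (1 - p) * log 2 (1 - p) - p * log 2 p)
    + p * (log 2 (card \<Omega> * N) - log 2 (card (K x))))"
proof -
  define Y where "Y x s = ((\<lambda>k. fst s + k) ` K x, snd s)" for x and s :: "'g \<times> nat"
  have coset_eq: "(\<lambda>k. u + k) ` K x = (\<lambda>k. v + k) ` K x \<longleftrightarrow> u - v \<in> K x" for u v x
  proof
    assume "(\<lambda>k. u + k) ` K x = (\<lambda>k. v + k) ` K x"
    moreover have "u + 0 \<in> (\<lambda>k. u + k) ` K x" using K(1)[of x] by (intro imageI) (simp add: additive_subgroup_def)
    ultimately show "u - v \<in> K x" by auto
  next
    have sub: "(\<lambda>k. u + k) ` K x \<subseteq> (\<lambda>k. v + k) ` K x" if "u - v \<in> K x" for u v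
    proof
      fix z assume "z \<in> (\<lambda>k. u + k) ` K x"
      then obtain k where "k \<in> K x" "z = u + k" by blast
      then show "z \<in> (\<lambda>k. v + k) ` K x"
        using additive_subgroup_add[OF K(1) that, of k] by (intro image_eqI[of _ _ "u - v + k"]) auto
    qed
    assume uv: "u - v \<in> K x"
    then have "0 - (u - v) \<in> K x" using K(1)[of x] unfolding additive_subgroup_def by blast
    then show "(\<lambda>k. u + k) ` K x = (\<lambda>k. v + k) ` K x" using sub[OF uv] sub[of v u] by auto
  qed
  have Y_eq: "Y x s = Y x s' \<longleftrightarrow> fst s - fst s' \<in> K x \<and> snd s = snd s'" for x s s'
    unfolding Y_def prod.inject coset_eq ..
  have "entropic (\<lambda>x. (- (1 - p) * log 2 (1 - p) - p * log 2 p)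
    + p * (log 2 (card (\<Omega> \<times> {..<N})) - log 2 (card (K x))))"
  proof (rule entropic_of_uniform_fibres[where Y = Y])
    show "finite (\<Omega> \<times> {..<N})" using \<Omega> by simp
    show "\<Omega> \<times> {..<N} \<noteq> {}" using \<Omega>(2) N by (auto simp: additive_subgroup_def)
    show "Y (sup x y) s = Y (sup x y) s' \<longleftrightarrow> Y x s = Y x s' \<and> Y y s = Y y s'" for x y s s'
      by (auto simp: Y_eq join)
    show "card {s' \<in> \<Omega> \<times> {..<N}. Y x s' = Y x s} = card (K x)" if s: "s \<in> \<Omega> \<times> {..<N}" for x s
    proof -
      have "{s' \<in> \<Omega> \<times> {..<N}. Y x s' = Y x s} = (\<lambda>k. (k + fst s, snd s)) ` K x"
      proof (intro set_eqI iffI)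
        fix z assume "z \<in> {s' \<in> \<Omega> \<times> {..<N}. Y x s' = Y x s}"
        then have "fst z - fst s \<in> K x" "snd z = snd s" by (auto simp: Y_eq)
        then show "z \<in> (\<lambda>k. (k + fst s, snd s)) ` K x"
          by (intro image_eqI[of _ _ "fst z - fst s"]) (auto simp: prod_eq_iff)
      next
        fix z assume "z \<in> (\<lambda>k. (k + fst s, snd s)) ` K x"
        then obtain k where k: "k \<in> K x" "z = (k + fst s, snd s)" by blast
        then have "k + fst s \<in> \<Omega>" using s K(2)[of x] \<Omega>(2) by (auto intro!: additive_subgroup_add)
        then show "z \<in> {s' \<in> \<Omega> \<times> {..<N}. Y x s' = Y x s}" using k s by (auto simp: Y_eq)
      qed
      then show ?thesis by (simp add: card_image inj_on_def)
    qed
  qed (use p in auto)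
  then show ?thesis by (simp add: card_cartesian_product)
qed

section \<open>Integer approximation and chain coordinates\<close>

text \<open>A minimal element below \<open>y\<close> but not below \<open>x\<close> works: all
  elements strictly below it lie below \<open>x\<close>, and so do their joins.\<close>

lemma join_irreducible_separates:
  fixes x y :: "'a::{finite,distrib_lattice}"
  assumes "\<not> y \<le> x"
  shows "\<exists>j. join_irreducible j \<and> j \<le> y \<and> \<not> j \<le> x"
proof -
  obtain z where z: "z \<in> {z. z \<le> y \<and> \<not> z \<le> x}" "\<forall>b\<in>{z. z \<le> y \<and> \<not> z \<le> x}. b \<le> z \<longrightarrow> z = b"
    using finite_has_minimal[of "{z. z \<le> y \<and> \<not> z \<le> x}"] assms by auto
  have "z = u \<or> z = v" if "z = sup u v" for u v
  proof (rule ccontr)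
    assume *: "\<not> (z = u \<or> z = v)"
    have "u \<le> z" "v \<le> z" using that by auto
    moreover have "w \<le> x" if "w \<le> z" "z \<noteq> w" for w
      using z that order_trans[of w z y] by blast
    ultimately have "u \<le> x" "v \<le> x" using * by blast+
    then show False using that z(1) by simp
  qed
  then show ?thesis using z(1) unfolding join_irreducible_def by blast
qed

section \<open>A modular rank and the rounding to integral polymatroids\<close>

definition ji_rank :: "'a::{finite,distrib_lattice} \<Rightarrow> nat" where
  "ji_rank x = card {j. join_irreducible j \<and> j \<le> x}"

text \<open>By primality, \<open>sup\<close> becomes the union of the sets of join-irreducibles
  below, as \<open>inf\<close> becomes their intersection.\<close>

lemma ji_rank_modular: "ji_rank (sup x y) + ji_rank (inf x y) = ji_rank x + ji_rank y"
proof -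
  have "{j. join_irreducible j \<and> j \<le> sup x y} = {j. join_irreducible j \<and> j \<le> x} \<union> {j. join_irreducible j \<and> j \<le> y}"
    by (auto simp: join_irreducible_le_sup_iff)
  moreover have "{j. join_irreducible j \<and> j \<le> inf x y} = {j. join_irreducible j \<and> j \<le> x} \<inter> {j. join_irreducible j \<and> j \<le> y}"
    by auto
  ultimately show ?thesis
    using card_Un_Int[of "{j. join_irreducible j \<and> j \<le> x}" "{j. join_irreducible j \<and> j \<le> y}"]
    unfolding ji_rank_def by simp
qed

lemma ji_rank_mono: "x \<le> y \<Longrightarrow> ji_rank x \<le> ji_rank y"
  unfolding ji_rank_def by (intro card_mono) (auto intro: order_trans)

lemma ji_rank_less: "x < y \<Longrightarrow> ji_rank x < ji_rank y"
proof -
  assume xy: "x < y"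
  then obtain j where "join_irreducible j" "j \<le> y" "\<not> j \<le> x"
    using join_irreducible_separates[of y x] by (auto simp: less_le_not_le)
  then have "{j. join_irreducible j \<and> j \<le> x} \<subset> {j. join_irreducible j \<and> j \<le> y}"
    using order_trans[OF _ less_imp_le[OF xy]] by blast
  then show ?thesis unfolding ji_rank_def by (intro psubset_card_mono) auto
qed

lemma ji_rank_le_card: "ji_rank (x :: 'a::{finite,distrib_lattice}) \<le> CARD('a)"
  unfolding ji_rank_def by (intro card_mono) auto

text \<open>Rounding \<open>N * h\<close> down spoils submodularity by at most one unit; the strictly concave function of
  the modular rank compensates for it.\<close>
definition integer_approx :: "('a::{finite,distrib_lattice} \<Rightarrow> real) \<Rightarrow> nat \<Rightarrow> 'a \<Rightarrow> nat" where
  "integer_approx h N x = nat \<lfloor>real N * h x\<rfloor> + ji_rank x * (2 * CARD('a) - ji_rank x)"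

lemma integer_approx_mono:
  fixes h :: "'a::{finite,distrib_lattice} \<Rightarrow> real"
  assumes "polymatroid h" "x \<le> y"
  shows "integer_approx h N x \<le> integer_approx h N y"
proof -
  have "h x \<le> h y" using assms by (simp add: polymatroid_def)
  then have "real N * h x \<le> real N * h y" by (simp add: mult_left_mono)
  then have 1: "nat \<lfloor>real N * h x\<rfloor> \<le> nat \<lfloor>real N * h y\<rfloor>" by (intro nat_mono floor_mono)
  define a b Q where "a = int (ji_rank x)" and "b = int (ji_rank y)" and "Q = int CARD('a)"
  have ab: "a \<le> b" "b \<le> Q" "0 \<le> a"
    using ji_rank_mono[OF assms(2)] ji_rank_le_card[of y] by (auto simp: a_def b_def Q_def)
  \<comment> \<open>\<open>t * (2 * Q - t)\<close> increases up to \<open>t = Q\<close>, and no rank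
    exceeds \<open>Q\<close>.\<close>
  have "0 \<le> (b - a) * (2 * Q - a - b)" using ab by (intro mult_nonneg_nonneg) auto
  then have "a * (2 * Q - a) \<le> b * (2 * Q - b)" by (simp add: algebra_simps)
  moreover have "int (ji_rank x * (2 * CARD('a) - ji_rank x)) = a * (2 * Q - a)"
    "int (ji_rank y * (2 * CARD('a) - ji_rank y)) = b * (2 * Q - b)"
    using ji_rank_le_card[of x] ji_rank_le_card[of y] by (auto simp: a_def b_def Q_def of_nat_diff)
  ultimately have "ji_rank x * (2 * CARD('a) - ji_rank x) \<le> ji_rank y * (2 * CARD('a) - ji_rank y)"
    by linarith
  then show ?thesis using 1 by (simp add: integer_approx_def)
qed

lemma integer_approx_submodular:
  fixes h :: "'a::{finite,distrib_lattice} \<Rightarrow> real"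
  assumes h: "polymatroid h"
  shows "integer_approx h N (sup x y) + integer_approx h N (inf x y) \<le> integer_approx h N x + integer_approx h N y"
proof (cases "x \<le> y \<or> y \<le> x")
  case True
  then show ?thesis by (auto simp: sup_absorb1 sup_absorb2 inf_absorb1 inf_absorb2)
next
  case False
  define a b c d Q where "a = int (ji_rank x)" and "b = int (ji_rank y)" and "c = int (ji_rank (sup x y))"
    and "d = int (ji_rank (inf x y))" and "Q = int CARD('a)"
  have "x < sup x y" "inf x y < x" using False by (auto simp: less_le_not_le)
  then have abcd: "a < c" "d < a" "c + d = a + b"
    using ji_rank_less[of x "sup x y"] ji_rank_less[of "inf x y" x] ji_rank_modular[of x y]
    by (auto simp: a_def b_def c_def d_def)
  \<comment> \<open>For incomparable elements concavity gains at least 2, whereas the floors lose at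
    most 1.\<close>
  have "1 * 1 \<le> (c - a) * (a - d)" using abcd by (intro mult_mono) auto
  moreover have b: "b = c + d - a" using abcd by simp
  have "a * (2 * Q - a) + b * (2 * Q - b) - c * (2 * Q - c) - d * (2 * Q - d) = 2 * ((c - a) * (a - d))"
    unfolding b by (simp add: algebra_simps)
  ultimately have conc: "c * (2 * Q - c) + d * (2 * Q - d) + 2 \<le> a * (2 * Q - a) + b * (2 * Q - b)"
    by linarith
  have eq: "int (integer_approx h N z) = \<lfloor>real N * h z\<rfloor> + int (ji_rank z) * (2 * Q - int (ji_rank z))" for z
  proof -
    have "0 \<le> real N * h z" using h by (simp add: polymatroid_def)
    then show ?thesis
      using ji_rank_le_card[of z] by (auto simp: integer_approx_def Q_def of_nat_diff)
  qed
  have "h (sup x y) + h (inf x y) \<le> h x + h y" using h by (simp add: polymatroid_def)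
  then have "real N * (h (sup x y) + h (inf x y)) \<le> real N * (h x + h y)" by (intro mult_left_mono) auto
  then have "real N * h (sup x y) + real N * h (inf x y) \<le> real N * h x + real N * h y"
    by (simp add: distrib_left)
  then have "\<lfloor>real N * h (sup x y)\<rfloor> + \<lfloor>real N * h (inf x y)\<rfloor> \<le> \<lfloor>real N * h x\<rfloor> + \<lfloor>real N * h y\<rfloor> + 1"
    by linarith
  then have "int (integer_approx h N (sup x y)) + int (integer_approx h N (inf x y)) \<le> int (integer_approx h N x) + int (integer_approx h N y)"
    unfolding eq using conc by (simp add: a_def b_def c_def d_def)
  then show ?thesis by linarith
qed

text \<open>The rank term does not depend on \<open>N\<close>, so it disappears in the limit
  together with the rounding error.\<close>

lemma integer_approx_tendsto:
  fixes h :: "'a::{finite,distrib_lattice} \<Rightarrow> real"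
  assumes "0 \<le> h x"
  shows "(\<lambda>N. real (integer_approx h N x) / real N) \<longlonglongrightarrow> h x"
proof (rule tendsto_sandwich)
  define q where "q = real (ji_rank x * (2 * CARD('a) - ji_rank x))"
  have eq: "real (integer_approx h N x) = real_of_int \<lfloor>real N * h x\<rfloor> + q" for N
    using assms by (simp add: integer_approx_def q_def)
  show "\<forall>\<^sub>F N in sequentially. h x - 1 / real N \<le> real (integer_approx h N x) / real N"
    using eventually_gt_at_top[of 0]
  proof eventually_elim
    case (elim N)
    have "real N * h x - 1 \<le> real (integer_approx h N x)" unfolding eq q_def by linarith
    then have "(real N * h x - 1) / real N \<le> real (integer_approx h N x) / real N" by (rule divide_right_mono) simp
    then show ?case using elim by (simp add: diff_divide_distrib)
  qed
  show "\<forall>\<^sub>F N in sequentially. real (integer_approx h N x) / real N \<le> h x + q / real N"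
    using eventually_gt_at_top[of 0]
  proof eventually_elim
    case (elim N)
    have "real (integer_approx h N x) \<le> real N * h x + q" unfolding eq by linarith
    then have "real (integer_approx h N x) / real N \<le> (real N * h x + q) / real N" by (rule divide_right_mono) simp
    then show ?case using elim by (simp add: add_divide_distrib)
  qed
  show "(\<lambda>N. h x - 1 / real N) \<longlonglongrightarrow> h x" "(\<lambda>N. h x + q / real N) \<longlonglongrightarrow> h x"
    using tendsto_diff[OF tendsto_const[of "h x"] lim_const_over_n[of "1::real"]]
      tendsto_add[OF tendsto_const[of "h x"] lim_const_over_n[of q]] by simp_all
qed

text \<open>\<open>A i\<close> is the greatest member of the chain of rank at most \<open>i\<close>,
  or bottom if there is none; \<open>idx x\<close> is the rank of the greatest member below
  \<open>x\<close>. Past \<open>CARD('a)\<close>, beyond every rank, \<open>A\<close> jumps to the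
  top, which later bounds the range of the flags.\<close>

lemma chain_coordinate:
  fixes F :: "'a::{finite,distrib_lattice} set"
  assumes F: "\<And>j. j \<in> F \<Longrightarrow> join_irreducible j" and chain: "\<And>i j. i \<in> F \<Longrightarrow> j \<in> F \<Longrightarrow> i \<le> j \<or> j \<le> i"
  shows "\<exists>(A :: nat \<Rightarrow> 'a) idx. mono A \<and> (\<forall>i x. CARD('a) < i \<longrightarrow> x \<le> A i) \<and>
    (\<forall>x y. idx (sup x y) = max (idx x) (idx y)) \<and>
    (\<forall>x. A (idx x) \<le> x) \<and> (\<forall>x. \<forall>j\<in>F. j \<le> x \<longrightarrow> j \<le> A (idx x))"
proof -
  define bt tp :: 'a where "bt = Inf_fin UNIV" and "tp = Sup_fin UNIV"
  have bt: "bt \<le> x" and tp: "x \<le> tp" for x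
    by (simp_all add: bt_def tp_def Inf_fin.coboundedI Sup_fin.coboundedI)
  define L where "L i = insert bt {j \<in> F. ji_rank j \<le> i}" for i
  define A where "A i = (if CARD('a) < i then tp else Sup_fin (L i))" for i
  define idx where "idx x = Max (insert 0 (ji_rank ` {j \<in> F. j \<le> x}))" for x
  have "mono A"
  proof (rule monoI)
    fix i i' :: nat assume "i \<le> i'"
    then have "L i \<subseteq> L i'" by (auto simp: L_def)
    then have "Sup_fin (L i) \<le> Sup_fin (L i')" by (intro Sup_fin.subset_imp) (auto simp: L_def)
    then show "A i \<le> A i'" using \<open>i \<le> i'\<close> tp by (auto simp: A_def)
  qed
  moreover have "x \<le> A i" if "CARD('a) < i" for i x using that tp by (simp add: A_def)
  moreover have "idx (sup x y) = max (idx x) (idx y)" for x y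
  proof -
    have "{j \<in> F. j \<le> sup x y} = {j \<in> F. j \<le> x} \<union> {j \<in> F. j \<le> y}"
      using F by (auto simp: join_irreducible_le_sup_iff)
    then have "insert 0 (ji_rank ` {j \<in> F. j \<le> sup x y}) =
        insert 0 (ji_rank ` {j \<in> F. j \<le> x}) \<union> insert 0 (ji_rank ` {j \<in> F. j \<le> y})" by auto
    then show ?thesis unfolding idx_def by (subst Max_Un[symmetric]) auto
  qed
  moreover have A_idx: "A (idx x) = Sup_fin (L (idx x))" for x
  proof -
    have "idx x \<le> CARD('a)" unfolding idx_def using ji_rank_le_card by (subst Max_le_iff) auto
    then show ?thesis by (simp add: A_def)
  qed
  moreover have "A (idx x) \<le> x" for x
    unfolding A_idx
  proof (rule Sup_fin.boundedI)
    fix j assume "j \<in> L (idx x)"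
    then consider "j = bt" | "j \<in> F" "ji_rank j \<le> idx x" by (auto simp: L_def)
    then show "j \<le> x"
    proof cases
      case 2
      \<comment> \<open>A join-irreducible counts itself, so its rank is positive and index 0 means
        that no member of \<open>F\<close> lies below \<open>x\<close>.\<close>
      have "{i. join_irreducible i \<and> i \<le> j} \<noteq> {}" using F[OF 2(1)] by auto
      then have "0 < ji_rank j" by (simp add: ji_rank_def card_gt_0_iff)
      moreover have "idx x \<in> insert 0 (ji_rank ` {j \<in> F. j \<le> x})" unfolding idx_def by (intro Max_in) auto
      ultimately obtain i where i: "i \<in> F" "i \<le> x" "idx x = ji_rank i" using 2(2) by auto
      have "j \<le> i" using chain[OF 2(1) i(1)] ji_rank_less[of i j] 2(2) i(3) by (auto simp: order_le_less)
      then show ?thesis using i(2) by (rule order_trans)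
    qed (simp add: bt)
  qed (auto simp: L_def)
  moreover have "j \<le> A (idx x)" if "j \<in> F" "j \<le> x" for x j
  proof -
    have "ji_rank j \<le> idx x" unfolding idx_def using that by (intro Max_ge) auto
    then show ?thesis unfolding A_idx using that by (intro Sup_fin.coboundedI) (auto simp: L_def)
  qed
  ultimately show ?thesis by (intro exI[of _ A] exI[of _ idx]) simp
qed

section \<open>Order dimension at most three\<close>

lemma antimono_max_Int:
  fixes S :: "nat \<Rightarrow> 'b set"
  assumes "antimono S"
  shows "S (max i j) = S i \<inter> S j"
  using antimonoD[OF assms, of i j] antimonoD[OF assms, of j i] by (auto simp: max_def)

lemma additive_subgroup_Int:
  "additive_subgroup K \<Longrightarrow> additive_subgroup L \<Longrightarrow> additive_subgroup (K \<inter> L)"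
  by (auto simp: additive_subgroup_def)

text \<open>The defect \<open>g tp - g x\<close> is the rank of the intersection of three flag
  members at the chain coordinates of \<open>x\<close>. Coordinates of joins are maxima and the
  flags descend, so joins become intersections.\<close>

lemma entropic_integer_polymatroid:
  fixes g :: "'a::{finite,distrib_lattice} \<Rightarrow> nat"
  assumes dim: "order_dimension TYPE('a) \<le> 3"
    and mono: "\<And>x y. x \<le> y \<Longrightarrow> g x \<le> g y"
    and submod: "\<And>x y. g (sup x y) + g (inf x y) \<le> g x + g y"
    and p: "0 < p" "p < 1"
  shows "entropic (\<lambda>x. (- (1 - p) * log 2 (1 - p) - p * log 2 p) + p * real (g x))"
proof -
  define bt tp :: 'a where "bt = Inf_fin UNIV" and "tp = Sup_fin UNIV"
  have bt: "bt \<le> x" and tp: "x \<le> tp" for x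
    by (simp_all add: bt_def tp_def Inf_fin.coboundedI Sup_fin.coboundedI)
  have "\<exists>f. (\<forall>x\<in>{j :: 'a. join_irreducible j}. f x < (3::nat)) \<and>
      (\<forall>x\<in>{j. join_irreducible j}. \<forall>y\<in>{j. join_irreducible j}. f x = f y \<longrightarrow> x \<le> y \<or> y \<le> x)"
    using dim unfolding order_dimension_le_iff by (intro dilworth) simp_all
  then obtain f where f: "\<forall>x\<in>{j :: 'a. join_irreducible j}. f x < (3::nat)"
      "\<forall>x\<in>{j. join_irreducible j}. \<forall>y\<in>{j. join_irreducible j}. f x = f y \<longrightarrow> x \<le> y \<or> y \<le> x"
    by (elim exE conjE)
  define F where "F c = {j. join_irreducible j \<and> f j = c}" for c
  have "\<exists>(A :: nat \<Rightarrow> 'a) idx. mono A \<and> (\<forall>i x. CARD('a) < i \<longrightarrow> x \<le> A i) \<and>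
    (\<forall>x y. idx (sup x y) = max (idx x) (idx y)) \<and>
    (\<forall>x. A (idx x) \<le> x) \<and> (\<forall>x. \<forall>j\<in>F c. j \<le> x \<longrightarrow> j \<le> A (idx x))" for c
    by (rule chain_coordinate) (use f(2) in \<open>auto simp: F_def\<close>)
  then obtain Ch :: "nat \<Rightarrow> nat \<Rightarrow> 'a" and idx :: "nat \<Rightarrow> 'a \<Rightarrow> nat" where
    ch: "\<forall>c. mono (Ch c) \<and> (\<forall>i x. CARD('a) < i \<longrightarrow> x \<le> Ch c i) \<and>
      (\<forall>x y. idx c (sup x y) = max (idx c x) (idx c y)) \<and>
      (\<forall>x. Ch c (idx c x) \<le> x) \<and> (\<forall>x. \<forall>j\<in>F c. j \<le> x \<longrightarrow> j \<le> Ch c (idx c x))"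
    by metis
  define X where "X i j k = sup (Ch 0 i) (sup (Ch 1 j) (Ch 2 k))" for i j k
  have X_idx: "X (idx 0 x) (idx 1 x) (idx 2 x) = x" for x
  proof (rule antisym)
    show "X (idx 0 x) (idx 1 x) (idx 2 x) \<le> x" using ch by (simp add: X_def)
    show "x \<le> X (idx 0 x) (idx 1 x) (idx 2 x)"
    proof (rule ccontr)
      assume "\<not> x \<le> X (idx 0 x) (idx 1 x) (idx 2 x)"
      then obtain j where j: "join_irreducible j" "j \<le> x" "\<not> j \<le> X (idx 0 x) (idx 1 x) (idx 2 x)"
        using join_irreducible_separates by blast
      have "f j = 0 \<or> f j = 1 \<or> f j = 2" using f(1) j(1) by force
      moreover have "j \<le> Ch (f j) (idx (f j) x)" using ch j(1,2) by (simp add: F_def)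
      ultimately show False using j(3) by (auto simp: X_def join_irreducible_le_sup_iff[OF j(1)])
    qed
  qed
  have X_mono: "X i j k \<le> X i' j' k'" if "i \<le> i'" "j \<le> j'" "k \<le> k'" for i i' j j' k k'
  proof -
    have "Ch c n \<le> Ch c n'" if "n \<le> n'" for c n n' using ch that by (auto dest: monoD)
    then show ?thesis using that unfolding X_def by (intro sup_mono) auto
  qed
  \<comment> \<open>The meet of two values of \<open>X\<close> may lie strictly above
    \<open>X\<close> at the smaller indices, so submodularity is used with \<open>r\<close> merely a
    common lower bound.\<close>
  have sub: "g s + g r \<le> g u + g v" if "r \<le> u" "r \<le> v" "s \<le> sup u v" for r s u v
    using submod[of u v] mono[OF that(3)] mono[of r "inf u v"] that(1,2) by simp
  have g_le: "g x \<le> g tp" for x by (rule mono[OF tp])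
  define R where "R k i j = g tp - g (X i j k)" for k i j
  have R: "R k i j + g (X i j k) = g tp" for k i j using g_le by (simp add: R_def)
  have "\<exists>A B C :: nat \<Rightarrow> (nat \<times> nat \<times> nat \<Rightarrow> 2) set. antimono A \<and> antimono B \<and> antimono C \<and>
    (\<forall>i. additive_subgroup (A i) \<and> additive_subgroup (B i) \<and> additive_subgroup (C i) \<and> finite (A i)) \<and>
    (\<forall>i j k. card (A i \<inter> B j \<inter> C k) = 2 ^ R k i j)"
  proof (rule three_flags_realization[where M = "Suc CARD('a)"])
    fix k i j
    show "R k i j = 0" if "Suc CARD('a) \<le> i \<or> Suc CARD('a) \<le> j"
    proof -
      \<comment> \<open>Past \<open>CARD('a)\<close> the chains reach the top, hence the required
        vanishing of \<open>R\<close>.\<close>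
      have "tp \<le> Ch 0 i \<or> tp \<le> Ch 1 j" using ch that by (auto simp: Suc_le_eq)
      then have "tp \<le> X i j k" unfolding X_def by (elim disjE) (simp_all add: le_supI1 le_supI2)
      then show ?thesis using mono[of tp "X i j k"] by (simp add: R_def)
    qed
    have "g (X (Suc i) (Suc j) k) + g (X i j k) \<le> g (X (Suc i) j k) + g (X i (Suc j) k)"
      by (intro sub X_mono) (simp_all add: X_def le_supI1 le_supI2)
    then show "R k (Suc i) j + R k i (Suc j) \<le> R k i j + R k (Suc i) (Suc j)"
      using R[of k i j] R[of k "Suc i" j] R[of k i "Suc j"] R[of k "Suc i" "Suc j"] by linarith
    have "g (X i j k) \<le> g (X i j (Suc k))" by (intro mono X_mono) auto
    then show "R (Suc k) i j \<le> R k i j" by (simp add: R_def)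
    have "g (X (Suc i) j (Suc k)) + g (X i j k) \<le> g (X (Suc i) j k) + g (X i j (Suc k))"
      by (intro sub X_mono) (simp_all add: X_def le_supI1 le_supI2)
    then show "R k (Suc i) j + R (Suc k) i j \<le> R k i j + R (Suc k) (Suc i) j"
      using R[of k i j] R[of k "Suc i" j] R[of "Suc k" i j] R[of "Suc k" "Suc i" j] by linarith
    have "g (X i (Suc j) (Suc k)) + g (X i j k) \<le> g (X i (Suc j) k) + g (X i j (Suc k))"
      by (intro sub X_mono) (simp_all add: X_def le_supI1 le_supI2)
    then show "R k i (Suc j) + R (Suc k) i j \<le> R k i j + R (Suc k) i (Suc j)"
      using R[of k i j] R[of k i "Suc j"] R[of "Suc k" i j] R[of "Suc k" i "Suc j"] by linarith
  qed
  then obtain A B C :: "nat \<Rightarrow> (nat \<times> nat \<times> nat \<Rightarrow> 2) set" where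
    am: "antimono A" "antimono B" "antimono C"
    and sg: "\<forall>i. additive_subgroup (A i) \<and> additive_subgroup (B i) \<and> additive_subgroup (C i) \<and> finite (A i)"
    and card: "\<forall>i j k. card (A i \<inter> B j \<inter> C k) = 2 ^ R k i j"
    by (elim exE conjE)
  define K where "K x = A (idx 0 x) \<inter> B (idx 1 x) \<inter> C (idx 2 x)" for x
  have cardK: "card (K x) = 2 ^ (g tp - g x)" for x
    unfolding K_def card[rule_format] R_def X_idx ..
  have sgK: "additive_subgroup (K x)" for x using sg by (simp add: K_def additive_subgroup_Int)
  have join: "K (sup x y) = K x \<inter> K y" for x y
    using ch by (auto simp: K_def am[THEN antimono_max_Int])
  \<comment> \<open>\<open>K bt\<close> serves as the ambient group; taking \<open>2 ^ g bt\<close>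
    for \<open>N\<close> accounts for a possibly nonzero \<open>g bt\<close>.\<close>
  have "entropic (\<lambda>x. (- (1 - p) * log 2 (1 - p) - p * log 2 p)
    + p * (log 2 (card (K bt) * (2 ^ g bt :: nat)) - log 2 (card (K x))))"
  proof (rule entropic_of_subgroups[OF _ sgK sgK _ join])
    show "finite (K bt)" using sg by (simp add: K_def)
    show "K x \<subseteq> K bt" for x using join[of x bt] bt[of x] by (simp add: sup_absorb1) blast
  qed (use p in auto)
  moreover have "log 2 (card (K bt) * (2 ^ g bt :: nat)) - log 2 (card (K x)) = real (g x)" for x
  proof -
    have "card (K bt) * (2 ^ g bt :: nat) = 2 ^ g tp"
      using g_le[of bt] by (simp add: cardK power_add[symmetric])
    then have "log 2 (card (K bt) * (2 ^ g bt :: nat)) = real (g tp)" by (simp add: log_nat_power)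
    moreover have "log 2 (card (K x)) = real (g tp - g x)" by (simp add: cardK log_nat_power)
    ultimately show ?thesis using g_le[of x] by simp
  qed
  ultimately show ?thesis by simp
qed

lemma polymatroid_in_closure_entropic:
  fixes h :: "'a::{finite,distrib_lattice} \<Rightarrow> real"
  assumes dim: "order_dimension TYPE('a) \<le> 3" and h: "polymatroid h"
  shows "h \<in> closure {h. entropic h}"
proof -
  define \<epsilon> :: "real \<Rightarrow> real" where "\<epsilon> p = - (1 - p) * log 2 (1 - p) - p * log 2 p" for p
  \<comment> \<open>The shift by 2 keeps \<open>p = 1 / (n + 2)\<close> strictly between 0 and 1;
    its binary entropy \<epsilon> tends to 0.\<close>
  define e where "e n x = \<epsilon> (1 / real (n + 2)) + real (integer_approx h (n + 2) x) / real (n + 2)" for n x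
  have ent: "entropic (e n)" for n
  proof -
    let ?p = "1 / real (n + 2)"
    have "entropic (\<lambda>x. (- (1 - ?p) * log 2 (1 - ?p) - ?p * log 2 ?p) + ?p * real (integer_approx h (n + 2) x))"
      by (rule entropic_integer_polymatroid[OF dim integer_approx_mono[OF h] integer_approx_submodular[OF h]]) auto
    moreover have "e n = (\<lambda>x. (- (1 - ?p) * log 2 (1 - ?p) - ?p * log 2 ?p) + ?p * real (integer_approx h (n + 2) x))"
      unfolding e_def \<epsilon>_def by (intro ext) simp
    ultimately show ?thesis by simp
  qed
  have "(\<lambda>n. e n x) \<longlonglongrightarrow> h x" for x
  proof -
    have l1: "(\<lambda>n. \<epsilon> (1 / real (n + 2))) \<longlonglongrightarrow> 0" unfolding \<epsilon>_def by real_asymp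
    have "0 \<le> h x" using h by (simp add: polymatroid_def)
    then have l2: "(\<lambda>n. real (integer_approx h (n + 2) x) / real (n + 2)) \<longlonglongrightarrow> h x"
      by (rule LIMSEQ_ignore_initial_segment[OF integer_approx_tendsto])
    show ?thesis using tendsto_add[OF l1 l2] by (simp only: e_def add_0)
  qed
  \<comment> \<open>The function space carries the product topology, so pointwise convergence
    suffices.\<close>
  then have "limitin (product_topology (\<lambda>_. euclidean) UNIV) e h sequentially"
    by (simp add: limitin_componentwise)
  then have "e \<longlonglongrightarrow> h"
    by (simp only: euclidean_product_topology limitin_canonical_iff)
  moreover have "\<forall>\<^sub>F n in sequentially. e n \<in> closure {h. entropic h}"
    by (intro always_eventually allI subsetD[OF closure_subset] CollectI ent)
  ultimately show ?thesis by (intro Lim_in_closed_set[OF closed_closure]) auto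
qed

theorem theorem14:
  shows "shannon_lattice TYPE('a::{finite,distrib_lattice}) \<longleftrightarrow>
         order_dimension TYPE('a) \<le> 3"
proof
  show "shannon_lattice TYPE('a) \<Longrightarrow> order_dimension TYPE('a) \<le> 3"
    by (rule shannon_lattice_imp_order_dimension_le_3)
  assume dim: "order_dimension TYPE('a) \<le> 3"
  have "closure {h :: 'a \<Rightarrow> real. entropic h} \<subseteq> {h. polymatroid h}"
    using entropic_imp_polymatroid closed_polymatroid by (intro closure_minimal) auto
  then show "shannon_lattice TYPE('a)"
    unfolding shannon_lattice_def using polymatroid_in_closure_entropic[OF dim] by blast
qed

end
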